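(* Let $k,d$ be positive integers with $k<d$. Then, as $n\to\infty$ along $\mathcal{N}_{d,k}$, asymptotically almost surely $\mathcal{G}_{n,d}$ has a $k$-star decomposition in each of the following cases: (i) $k=2$, or $d$ is an even multiple of $k$; (ii) $d\ge 2k^2+k$; (iii) $k$ is odd and $3\le k<d/2$.
   Context: $\mathcal{G}_{n,d}$ denotes the uniformly random (simple) $d$-regular graph on vertex set $[n]$. A $k$-star is the complete bipartite graph $K_{1,k}$; a $k$-star decomposition of a graph $G$ is a partition of $E(G)$ into edge-disjoint copies of $K_{1,k}$. Let $\mathcal{N}_{d,k}=\{n\in\mathbb{Z}^+ : 2k \text{ divides } dn\}$. An event holds asymptotically almost surely (a.a.s.) if its probability tends to $1$ as $n\to\infty$ (here along $\mathcal{N}_{d,k}$). *)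

theory Defs
  imports "HOL-Analysis.Analysis"
begin

text \<open>Simple graphs on the vertex set [n] = {1..n}, represented by their edge sets:
  an edge is a 2-element subset of {1..n}.\<close>

definition all_edges :: "nat \<Rightarrow> nat set set" where
  "all_edges n = {e. e \<subseteq> {1..n} \<and> card e = 2}"

definition regular_graphs :: "nat \<Rightarrow> nat \<Rightarrow> nat set set set" where
  "regular_graphs n d =
     {E. E \<subseteq> all_edges n \<and> (\<forall>v\<in>{1..n}. card {e\<in>E. v \<in> e} = d)}"

text \<open>A set S of edges is a copy of the k-star K_{1,k}: k edges sharing a common centre
  (the edges are distinct 2-sets, so the other endpoints are k distinct leaves).\<close>
definition is_k_star :: "nat \<Rightarrow> nat set set \<Rightarrow> bool" where
  "is_k_star k S \<longleftrightarrow> card S = k \<and> (\<exists>v. \<forall>e\<in>S. v \<in> e)"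

definition has_star_decomposition :: "nat \<Rightarrow> nat set set \<Rightarrow> bool" where
  "has_star_decomposition k E \<longleftrightarrow>
     (\<exists>P. \<Union>P = E \<and> (\<forall>S\<in>P. is_k_star k S) \<and>
          (\<forall>S\<in>P. \<forall>T\<in>P. S \<noteq> T \<longrightarrow> S \<inter> T = {}))"

definition prob_star_decomp :: "nat \<Rightarrow> nat \<Rightarrow> nat \<Rightarrow> real" where
  "prob_star_decomp n d k =
     real (card {E \<in> regular_graphs n d. has_star_decomposition k E})
       / real (card (regular_graphs n d))"

definition N_dk :: "nat \<Rightarrow> nat \<Rightarrow> nat set" where
  "N_dk d k = {n. 0 < n \<and> 2 * k dvd d * n}"

end

theory Submission
  imports Defs "HOL-Real_Asymp.Real_Asymp"
begin

text \<open>A star decomposition is an orientation in which every out-degree is divisible by k, that is,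
  in which the net out-flow of every vertex is congruent to -d modulo 2k. For k at least 2 the three
  cases of the theorem all imply d + 1 \<ge> 2k and d \<ge> 3, and under this assumption such an orientation
  exists as soon as every vertex set A with at most n/2 elements has at least 3k - 2 boundary
  edges or spans at most |A| edges. This follows from an orientation theorem for multigraphs in the spirit of
  Lovasz, Thomassen, Wu and Zhang: if every proper cut A has at least 2k - 2 + |t(A)| edges, where
  |t(A)| is the distance of the prescribed net out-flow t(A) to the multiples of 2k, then t can be
  realised modulo 2k. A minimal counterexample is reduced by contracting tight sets, lifting
  pairs of edges and orienting and deleting single edges.

  That the cut condition holds asymptotically almost surely is a first moment computation. For a fixed set
  A the number of d-regular graphs with c boundary edges is compared with the number of those with c + 2,
  c + 4, ... boundary edges by switching an edge inside A with an edge outside A; |A| + 1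
  switchings gain a factor that beats the number of sets A by a factor of order n.\<close>

section \<open>Orientations of multigraphs with prescribed net flow modulo 2k\<close>

text \<open>Solving a contracted graph first leaves the inside of a tight set with its boundary
  already oriented, so the inductive statement must admit one special vertex with preoriented edges;
  tightness of the set is exactly the degree bound \<open>root_le\<close> at that vertex. Lifting at
  a vertex with vanishing demand eventually destroys the cut condition at that vertex alone, so one
  singleton may be exempt. The constant 3k - 2 is 2k - 2 plus k, the largest possible distance to
  the multiples of 2k. The inequality d + 1 >= 2k is what singletons ask for: it gives d >= 2k - 2 +
  |d|. The alternative of at most |A| spanned edges is forced from two sides. Short cycles span as
  many edges as vertices and cannot be excluded asymptotically almost surely; and |A| + 1 switchings
  can be performed only while more than |A| edges remain inside A. For |A| of order n the gain of
  |A| switchings over the binomial coefficient is exponential with base 16/27, which leaves room for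
  cruder estimates elsewhere.\<close>

definition mod_norm :: "int \<Rightarrow> int \<Rightarrow> int" where
  "mod_norm k t = min (t mod (2 * k)) ((- t) mod (2 * k))"

lemma mod_norm_nonneg: "k > 0 \<Longrightarrow> 0 \<le> mod_norm k t"
  by (simp add: mod_norm_def)

lemma mod_norm_attained:
  assumes "k > 0" obtains j where "mod_norm k t = \<bar>t - 2 * k * j\<bar>"
proof -
  have 1: "t mod (2 * k) = t - 2 * k * (t div (2 * k))"
    by (simp add: minus_mult_div_eq_mod)
  have 2: "(- t) mod (2 * k) = - t - 2 * k * ((- t) div (2 * k))"
    by (simp add: minus_mult_div_eq_mod [symmetric])
  have "t mod (2 * k) \<ge> 0" "(- t) mod (2 * k) \<ge> 0" using assms by auto
  then have "mod_norm k t = \<bar>t - 2 * k * (t div (2 * k))\<bar> \<or> mod_norm k t = \<bar>t - 2 * k * (- ((- t) div (2 * k)))\<bar>"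
    unfolding mod_norm_def using 1 2 by (simp add: min_def)
  then show ?thesis using that by blast
qed

lemma mod_norm_le: assumes "k > 0" shows "mod_norm k t \<le> \<bar>t - 2 * k * j\<bar>"
proof (cases "t - 2 * k * j \<ge> 0")
  case True
  have "t mod (2 * k) = (t - 2 * k * j) mod (2 * k)" by (simp add: mod_diff_right_eq [symmetric])
  also have "\<dots> \<le> t - 2 * k * j" using True assms by (simp add: zmod_le_nonneg_dividend)
  finally show ?thesis using True unfolding mod_norm_def by linarith
next
  case False
  have "(- t) mod (2 * k) = (- t + 2 * k * j) mod (2 * k)" by (rule mod_mult_self2[symmetric])
  also have "\<dots> \<le> - t + 2 * k * j" using False assms by (intro zmod_le_nonneg_dividend) auto
  finally show ?thesis using False unfolding mod_norm_def by linarith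
qed

lemma mod_norm_le_abs: "k > 0 \<Longrightarrow> mod_norm k t \<le> \<bar>t\<bar>"
  using mod_norm_le[of k t 0] by simp

lemma mod_norm_le_modulus: assumes "k > 0" shows "mod_norm k t \<le> k"
proof -
  have "t mod (2*k) < 2*k" "t mod (2*k) \<ge> 0" using assms by auto
  moreover have "(-t) mod (2*k) = (if t mod (2*k) = 0 then 0 else 2*k - t mod (2*k))"
    by (rule zmod_zminus1_eq_if)
  ultimately show ?thesis unfolding mod_norm_def using assms by (auto simp: min_def)
qed

lemma mod_norm_minus [simp]: "mod_norm k (- t) = mod_norm k t"
  by (simp add: mod_norm_def min.commute)

lemma mod_norm_cong: assumes "2 * k dvd s - t" shows "mod_norm k s = mod_norm k t"
proof -
  have "s mod (2*k) = t mod (2*k)" using assms by (simp add: mod_eq_dvd_iff)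
  moreover have "(- s) mod (2*k) = (- t) mod (2*k)"
    using \<open>s mod (2*k) = t mod (2*k)\<close> by (metis mod_minus_eq)
  ultimately show ?thesis by (simp add: mod_norm_def)
qed

lemma mod_norm_triangle: assumes "k > 0" shows "mod_norm k (s + t) \<le> mod_norm k s + mod_norm k t"
proof -
  obtain i j where "mod_norm k s = \<bar>s - 2 * k * i\<bar>" "mod_norm k t = \<bar>t - 2 * k * j\<bar>"
    using mod_norm_attained[OF assms] by metis
  moreover have "mod_norm k (s + t) \<le> \<bar>s + t - 2 * k * (i + j)\<bar>" using mod_norm_le[OF assms] by blast
  moreover have "s + t - 2 * k * (i + j) = (s - 2*k*i) + (t - 2*k*j)" by (simp add: algebra_simps)
  ultimately show ?thesis by linarith
qed

lemma mod_norm_lipschitz: assumes "k > 0" shows "mod_norm k s \<le> mod_norm k t + \<bar>s - t\<bar>"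
  using mod_norm_triangle[OF assms, of t "s - t"] mod_norm_le_abs[OF assms, of "s - t"] by simp

lemma even_mod_norm: assumes "k > 0" shows "even (mod_norm k t + t)"
proof -
  obtain j where "mod_norm k t = \<bar>t - 2 * k * j\<bar>" using mod_norm_attained[OF assms] .
  then show ?thesis by (cases "t - 2 * k * j \<ge> 0") auto
qed

lemma mod_norm_small: assumes "k > 0" "0 \<le> s" "s \<le> k" shows "mod_norm k s = s"
proof (rule antisym)
  show "mod_norm k s \<le> s" using mod_norm_le_abs[OF assms(1), of s] assms by simp
  obtain j where j: "mod_norm k s = \<bar>s - 2 * k * j\<bar>" using mod_norm_attained[OF assms(1)] .
  show "s \<le> mod_norm k s"
  proof (cases "j \<le> 0")
    case True
    then have "k * j \<le> 0" using assms by (simp add: mult_nonneg_nonpos)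
    then show ?thesis unfolding j by linarith
  next
    case False
    then have "k * j \<ge> k * 1" using assms by (intro mult_left_mono) auto
    then show ?thesis unfolding j using assms by linarith
  qed
qed

lemma mod_norm_eq_0_iff: assumes "k > 0" shows "mod_norm k t = 0 \<longleftrightarrow> 2 * k dvd t"
proof
  assume "mod_norm k t = 0"
  moreover obtain j where "mod_norm k t = \<bar>t - 2 * k * j\<bar>" using mod_norm_attained[OF assms] .
  ultimately show "2 * k dvd t" by auto
next
  assume "2 * k dvd t"
  then have "mod_norm k t = mod_norm k 0" by (intro mod_norm_cong) simp
  then show "mod_norm k t = 0" by (simp add: mod_norm_def)
qed

text \<open>For positive k this means that the residue of t modulo 2k lies in {1..k}, so that
  spending one unit of demand brings it nearer to a multiple of 2k. The residue k is positive and
  negative at once.\<close>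

definition mod_pos :: "int \<Rightarrow> int \<Rightarrow> bool" where "mod_pos k t \<longleftrightarrow> mod_norm k (t - 1) = mod_norm k t - 1"

lemma pos_or_neg:
  assumes "k > 0" "mod_norm k t \<noteq> 0" shows "mod_pos k t \<or> mod_pos k (- t)"
proof -
  obtain j where j: "mod_norm k t = \<bar>t - 2 * k * j\<bar>" using mod_norm_attained[OF assms(1)] .
  show ?thesis
  proof (cases "t - 2 * k * j > 0")
    case True
    have "mod_norm k (t - 1) \<le> \<bar>t - 1 - 2 * k * j\<bar>" by (rule mod_norm_le[OF assms(1)])
    then have "mod_norm k (t - 1) \<le> mod_norm k t - 1" using True j by linarith
    then show ?thesis using mod_norm_lipschitz[OF assms(1), of t "t - 1"] unfolding mod_pos_def by simp
  next
    case False
    have "mod_norm k (- t - 1) \<le> \<bar>- t - 1 - 2 * k * (- j)\<bar>" by (rule mod_norm_le[OF assms(1)])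
    moreover have "\<bar>- t - 1 - 2 * k * (- j)\<bar> = \<bar>t - 2 * k * j + 1\<bar>" by simp
    ultimately have "mod_norm k (- t - 1) \<le> mod_norm k t - 1" using False j assms by linarith
    then show ?thesis using mod_norm_lipschitz[OF assms(1), of "- t" "- t - 1"] unfolding mod_pos_def by simp
  qed
qed

lemma pos_repr:
  assumes "k > 0" "mod_pos k t" shows "2 * k dvd t - mod_norm k t" "mod_norm k t \<ge> 1"
proof -
  obtain j where j: "mod_norm k (t - 1) = \<bar>t - 1 - 2 * k * j\<bar>" using mod_norm_attained[OF assms(1)] .
  have "mod_norm k t \<le> \<bar>t - 2 * k * j\<bar>" by (rule mod_norm_le[OF assms(1)])
  then have *: "mod_norm k t = t - 2 * k * j \<and> mod_norm k t \<ge> 1"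
    using j assms(2) unfolding mod_pos_def by linarith
  then show "mod_norm k t \<ge> 1" by simp
  have "t - mod_norm k t = 2 * k * j" using * by linarith
  then show "2 * k dvd t - mod_norm k t" by simp
qed

text \<open>The increase takes t past residue k to k + 1, which is already nearer to 2k than to 0.
  Demand may thus be raised and its distance still end up at most k - 1.\<close>

lemma pos_wrap:
  assumes "k > 0" "mod_pos k t" shows "mod_norm k (t + (k - mod_norm k t) + 1) \<le> k - 1"
proof -
  have "mod_norm k (t + (k - mod_norm k t) + 1) = mod_norm k (k + 1)"
    using pos_repr(1)[OF assms] by (intro mod_norm_cong) (simp add: algebra_simps)
  also have "\<dots> \<le> k - 1" using mod_norm_le[OF assms(1), of "k+1" 1] assms(1) by simp
  finally show ?thesis .
qed

section \<open>Multigraphs as multiplicity functions, cuts and demands\<close>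

definition point :: "'a \<Rightarrow> 'a \<Rightarrow> int" where "point x v = (if v = x then 1 else 0)"

text \<open>The multiplicity function of a single edge xy. Deleting, adding and lifting edges become
  pointwise sums, and their effect on any cut is read off from \<open>sum_edge\<close>.\<close>

definition edge :: "'a \<Rightarrow> 'a \<Rightarrow> 'a \<Rightarrow> 'a \<Rightarrow> int" where
  "edge x y u v = point x u * point y v + point y u * point x v"

lemma sum_point: "finite A \<Longrightarrow> sum (point x) A = (if x \<in> A then 1 else 0)"
  by (simp add: point_def)

lemma sum_edge: "finite A \<Longrightarrow> finite B \<Longrightarrow> (\<Sum>u\<in>A. \<Sum>v\<in>B. edge x y u v) =
    (if x \<in> A \<and> y \<in> B then 1 else 0) + (if y \<in> A \<and> x \<in> B then 1 else 0)"
  by (simp add: edge_def sum.distrib sum_distrib_left [symmetric] sum_distrib_right [symmetric] sum_point)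

lemma sum_edge_row: "finite B \<Longrightarrow> (\<Sum>v\<in>B. edge x y u v) =
    point x u * (if y \<in> B then 1 else 0) + point y u * (if x \<in> B then 1 else 0)"
  by (simp add: edge_def sum.distrib sum_distrib_left [symmetric] sum_point)

lemma edge_commute: "edge x y u v = edge x y v u"
  by (simp add: edge_def mult.commute)

text \<open>A multigraph on V is given by its symmetric multiplicity function m. A deleted special vertex is
  remembered only through p and q: p v edges run from it to v and q v edges run from v to it.
  The function b is the net out-flow required inside V, so that \<^term>\<open>sum b A - sum p A + sum q A\<close>
  is the net out-flow of A when the edges at the special vertex are counted as well.\<close>

definition cut_deg :: "'a set \<Rightarrow> ('a \<Rightarrow> 'a \<Rightarrow> int) \<Rightarrow> ('a \<Rightarrow> int) \<Rightarrow> ('a \<Rightarrow> int) \<Rightarrow> 'a set \<Rightarrow> int" where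
  "cut_deg V m p q A = (\<Sum>u\<in>A. \<Sum>v\<in>V - A. m u v) + sum p A + sum q A"

definition demand :: "('a \<Rightarrow> int) \<Rightarrow> ('a \<Rightarrow> int) \<Rightarrow> ('a \<Rightarrow> int) \<Rightarrow> 'a set \<Rightarrow> int" where
  "demand b p q A = sum b A - sum p A + sum q A"

definition net :: "'a set \<Rightarrow> ('a \<Rightarrow> 'a \<Rightarrow> int) \<Rightarrow> 'a \<Rightarrow> int" where
  "net V f v = (\<Sum>u\<in>V. f v u - f u v)"

text \<open>\<open>f u v\<close> is the number of parallel edges between u and v that are directed
  from u to v.\<close>

definition orients :: "'a set \<Rightarrow> ('a \<Rightarrow> 'a \<Rightarrow> int) \<Rightarrow> ('a \<Rightarrow> 'a \<Rightarrow> int) \<Rightarrow> bool" where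
  "orients V m f \<longleftrightarrow> (\<forall>u\<in>V. \<forall>v\<in>V. 0 \<le> f u v \<and> f u v + f v u = m u v)"

definition solvable :: "int \<Rightarrow> 'a set \<Rightarrow> ('a \<Rightarrow> 'a \<Rightarrow> int) \<Rightarrow> ('a \<Rightarrow> int) \<Rightarrow> bool" where
  "solvable k V m b \<longleftrightarrow> (\<exists>f. orients V m f \<and> (\<forall>v\<in>V. 2 * k dvd net V f v - b v))"

section \<open>Pulling solutions back along orienting, lifting, reversing and contracting\<close>

lemma even_sum_symmetric:
  fixes m :: "'a \<Rightarrow> 'a \<Rightarrow> int"
  assumes "finite A" "\<And>u v. m u v = m v u" "\<And>v. m v v = 0"
  shows "even (\<Sum>u\<in>A. \<Sum>v\<in>A. m u v)"
  using assms(1)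
proof (induction A)
  case (insert x A)
  have "(\<Sum>u\<in>A. m u x) = (\<Sum>v\<in>A. m x v)" using assms(2) by (intro sum.cong) auto
  then have "(\<Sum>u\<in>insert x A. \<Sum>v\<in>insert x A. m u v) = (\<Sum>u\<in>A. \<Sum>v\<in>A. m u v) + 2 * (\<Sum>v\<in>A. m x v)"
    using insert.hyps assms(3) by (simp add: sum.distrib)
  then show ?case using insert.IH by simp
qed simp

lemma solvable_orient_edge:
  assumes V: "finite V" "x \<in> V" "y \<in> V" "x \<noteq> y"
    and sol: "solvable k V (\<lambda>u v. m u v - edge x y u v) (\<lambda>v. b v - point x v + point y v)"
  shows "solvable k V m b"
proof -
  obtain f where f: "orients V (\<lambda>u v. m u v - edge x y u v) f"
     "\<And>v. v \<in> V \<Longrightarrow> 2 * k dvd net V f v - (b v - point x v + point y v)"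
    using sol unfolding solvable_def by blast
  define g where "g u v = f u v + point x u * point y v" for u v
  have "orients V m g"
    using f(1) unfolding orients_def g_def
    by (auto simp: edge_def algebra_simps point_def)
  moreover have *: "net V g v = net V f v + point x v - point y v" for v
    using V by (simp add: net_def g_def sum.distrib sum_subtractf sum_distrib_left[symmetric]
        sum_distrib_right[symmetric] sum_point)
  have "2 * k dvd net V g v - b v" if "v \<in> V" for v
  proof -
    have "net V g v - b v = net V f v - (b v - point x v + point y v)" using * by simp
    then show ?thesis using f(2)[OF that] by (simp only:)
  qed
  ultimately show ?thesis unfolding solvable_def by blast
qed

text \<open>The new edge yw is rerouted through x, which gains one incoming and one outgoing edge,
  so every net flow is preserved.\<close>

lemma solvable_lift:
  assumes V: "finite V" "x \<in> V" "y \<in> V" "w \<in> V" "x \<noteq> y" "x \<noteq> w" "y \<noteq> w"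
    and m: "m y w \<ge> 0"
    and sol: "solvable k V (\<lambda>u v. m u v - edge x y u v - edge x w u v + edge y w u v) b"
  shows "solvable k V m b"
proof -
  obtain f where f: "orients V (\<lambda>u v. m u v - edge x y u v - edge x w u v + edge y w u v) f"
     "\<And>v. v \<in> V \<Longrightarrow> 2 * k dvd net V f v - b v"
    using sol unfolding solvable_def by blast
  have "\<exists>g. orients V m g \<and> (\<forall>v. net V g v = net V f v)"
  proof -
    have main: "\<exists>g. orients V m g \<and> (\<forall>v. net V g v = net V f v)"
      if f1: "orients V (\<lambda>u v. m u v - edge x y u v - edge x w u v + edge y w u v) f"
        and yw: "y \<in> V" "w \<in> V" "x \<noteq> y" "x \<noteq> w" "y \<noteq> w" and fyw: "f y w \<ge> 1" for f y w
    proof -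
      define g where "g u v = f u v - point y u * point w v + point y u * point x v + point x u * point w v" for u v
      have "orients V m g"
        using f1 fyw yw unfolding orients_def g_def
        by (auto simp: edge_def algebra_simps point_def)
      moreover have "net V g v = net V f v" for v
        using V yw by (simp add: net_def g_def sum.distrib sum_subtractf sum_distrib_left[symmetric]
            sum_distrib_right[symmetric] sum_point)
      ultimately show ?thesis by blast
    qed
    have "f y w \<ge> 0" "f w y \<ge> 0" "f y w + f w y = m y w + 1"
      using f(1) V unfolding orients_def by (auto simp: edge_def point_def)
    \<comment> \<open>Parallel edges are indistinguishable, so any edge between y and w may play the
      role of the lifted one. At least one exists, and the two directions are symmetric in y and
      w.\<close>
    then have "f y w \<ge> 1 \<or> f w y \<ge> 1" using m by linarith
    moreover have "orients V (\<lambda>u v. m u v - edge x w u v - edge x y u v + edge w y u v) f"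
      using f(1) unfolding orients_def by (simp add: edge_def algebra_simps)
    ultimately show ?thesis using main[where f=f and y=y and w=w] main[where f=f and y=w and w=y] f(1) V by blast
  qed
  then show ?thesis using f(2) unfolding solvable_def by metis
qed

lemma solvable_negate:
  assumes "solvable k V m (\<lambda>v. - b v)" shows "solvable k V m b"
proof -
  obtain f where f: "orients V m f" "\<And>v. v \<in> V \<Longrightarrow> 2 * k dvd net V f v + b v"
    using assms unfolding solvable_def by auto
  have "orients V m (\<lambda>u v. f v u)" using f(1) unfolding orients_def
    by (simp add: add.commute)
  moreover have "net V (\<lambda>u v. f v u) v = - net V f v" for v
    by (simp add: net_def sum_negf[symmetric])
  ultimately show ?thesis unfolding solvable_def
    using f(2) by (intro exI[of _ "\<lambda>u v. f v u"]) (metis dvd_minus_iff minus_diff_commute minus_minus diff_minus_eq_add minus_add_distrib uminus_add_conv_diff)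
qed

text \<open>Distributes the flow between an outside vertex and a contracted set over the individual
  members of that set.\<close>

lemma split_bounded_sum:
  fixes h :: "'a \<Rightarrow> int"
  assumes "finite A" "\<And>w. w \<in> A \<Longrightarrow> 0 \<le> h w" "0 \<le> F" "F \<le> sum h A"
  shows "\<exists>g. (\<forall>w\<in>A. 0 \<le> g w \<and> g w \<le> h w) \<and> sum g A = F"
  using assms
proof (induction A arbitrary: F)
  case (insert x A)
  define F1 where "F1 = min F (sum h A)"
  have "sum h A \<ge> 0" using insert.prems(1) by (intro sum_nonneg) auto
  then have "0 \<le> F1" "F1 \<le> sum h A" using insert.prems unfolding F1_def by auto
  then obtain g where g: "\<forall>w\<in>A. 0 \<le> g w \<and> g w \<le> h w" "sum g A = F1"
    using insert.IH[of F1] insert.prems(1) by auto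
  have "sum (g(x := F - F1)) A = sum g A" using insert.hyps by (intro sum.cong) auto
  then have "sum (g(x := F - F1)) (insert x A) = F" using insert.hyps g by simp
  moreover have "0 \<le> F - F1" "F - F1 \<le> h x"
    using insert.prems insert.prems(1)[of x] insert.hyps unfolding F1_def by (auto simp: min_def)
  ultimately show ?case using g by (intro exI[of _ "g(x := F - F1)"]) auto
qed auto

text \<open>The original vertices that v stands for once A has been contracted to its member
  a.\<close>

definition block :: "'a set \<Rightarrow> 'a \<Rightarrow> 'a \<Rightarrow> 'a set" where
  "block A a v = (if v = a then A else {v})"

definition contract_mult :: "'a set \<Rightarrow> 'a \<Rightarrow> ('a \<Rightarrow> 'a \<Rightarrow> int) \<Rightarrow> 'a \<Rightarrow> 'a \<Rightarrow> int" where
  "contract_mult A a m u v = (if u = v then 0 else \<Sum>u'\<in>block A a u. \<Sum>v'\<in>block A a v. m u' v')"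

text \<open>A solution outside A fixes only how many edges leave A towards each outside vertex. Any
  distribution \<open>g\<close> of these numbers over A is acceptable, and the flow it carries is
  charged to the demands inside A. As the outer solution is not known beforehand,
  \<open>inner\<close> is required for every balanced \<open>g\<close>.\<close>

lemma solvable_contract:
  fixes m :: "'a \<Rightarrow> 'a \<Rightarrow> int"
  assumes fin: "finite V" and A: "A \<subseteq> V" "a \<in> A"
    and m: "\<And>u v. m u v = m v u" "\<And>u v. 0 \<le> m u v" "\<And>v. m v v = 0"
    and outer: "solvable k (insert a (V - A)) (contract_mult A a m) (\<lambda>v. sum b (block A a v))"
    and inner: "\<And>g. (\<And>w v. w \<in> A \<Longrightarrow> v \<in> V - A \<Longrightarrow> 0 \<le> g w v \<and> g w v \<le> m w v) \<Longrightarrow>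
        2 * k dvd (\<Sum>w\<in>A. b w - (\<Sum>v\<in>V - A. 2 * g w v - m w v)) \<Longrightarrow>
        solvable k A m (\<lambda>w. b w - (\<Sum>v\<in>V - A. 2 * g w v - m w v))"
  shows "solvable k V m b"
proof -
  define V1 where "V1 = insert a (V - A)"
  have finA: "finite A" using fin A finite_subset by auto
  obtain f1 where f1: "orients V1 (contract_mult A a m) f1"
      "\<And>v. v \<in> V1 \<Longrightarrow> 2 * k dvd net V1 f1 v - sum b (block A a v)"
    using outer unfolding solvable_def V1_def by blast
  have ca: "contract_mult A a m a v = (\<Sum>w\<in>A. m w v)" if "v \<in> V - A" for v
    using that A by (auto simp: contract_mult_def block_def)
  have f1a: "f1 a v + f1 v a = (\<Sum>w\<in>A. m w v)" "f1 a v \<ge> 0" "f1 v a \<ge> 0" if "v \<in> V - A" for v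
    using f1(1) that ca unfolding orients_def V1_def by auto
  have "\<exists>g. (\<forall>w\<in>A. 0 \<le> g w \<and> g w \<le> m w v) \<and> sum g A = f1 a v" if "v \<in> V - A" for v
    using f1a[OF that] m(2) finA by (intro split_bounded_sum) auto
  then obtain G where G: "\<And>v. v \<in> V - A \<Longrightarrow> (\<forall>w\<in>A. 0 \<le> G v w \<and> G v w \<le> m w v) \<and> sum (G v) A = f1 a v"
    by metis
  define g where "g w v = G v w" for w v
  have g: "0 \<le> g w v \<and> g w v \<le> m w v" if "w \<in> A" "v \<in> V - A" for w v
    using G that unfolding g_def by auto
  have gs: "(\<Sum>w\<in>A. g w v) = f1 a v" if "v \<in> V - A" for v
    using G[OF that] unfolding g_def by auto
  have "net V1 f1 a = (\<Sum>v\<in>V - A. f1 a v - f1 v a)"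
    using fin A unfolding net_def V1_def by simp
  also have "\<dots> = (\<Sum>v\<in>V - A. 2 * (\<Sum>w\<in>A. g w v) - (\<Sum>w\<in>A. m w v))"
    using f1a gs by (intro sum.cong) (auto simp: algebra_simps)
  also have "\<dots> = (\<Sum>v\<in>V - A. \<Sum>w\<in>A. 2 * g w v - m w v)"
    by (simp add: sum_subtractf sum_distrib_left)
  also have "\<dots> = (\<Sum>w\<in>A. \<Sum>v\<in>V - A. 2 * g w v - m w v)" by (rule sum.swap)
  finally have neta: "net V1 f1 a = (\<Sum>w\<in>A. \<Sum>v\<in>V - A. 2 * g w v - m w v)" .
  have "2 * k dvd net V1 f1 a - sum b A" using f1(2)[of a] unfolding V1_def block_def by simp
  then have "2 * k dvd sum b A - net V1 f1 a" by (simp add: dvd_diff_commute)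
  then have "2 * k dvd (\<Sum>w\<in>A. b w - (\<Sum>v\<in>V - A. 2 * g w v - m w v))"
    by (simp add: neta sum_subtractf)
  then have "solvable k A m (\<lambda>w. b w - (\<Sum>v\<in>V - A. 2 * g w v - m w v))" using inner g by blast
  then obtain f2 where f2: "orients A m f2"
     "\<And>w. w \<in> A \<Longrightarrow> 2 * k dvd net A f2 w - (b w - (\<Sum>v\<in>V - A. 2 * g w v - m w v))"
    unfolding solvable_def by blast
  \<comment> \<open>Three orientations are glued: \<open>f2\<close> inside A, \<open>g\<close>
    across the boundary, and \<open>f1\<close> outside A.\<close>
  define f where "f u v = (if u \<in> A then if v \<in> A then f2 u v else g u v
     else if v \<in> A then m u v - g v u else f1 u v)" for u v
  have "orients V m f"
    unfolding orients_def
  proof (intro ballI)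
    fix u v assume uv: "u \<in> V" "v \<in> V"
    have "f1 u v \<ge> 0 \<and> f1 u v + f1 v u = m u v" if "u \<notin> A" "v \<notin> A"
    proof -
      have "u \<in> V1" "v \<in> V1" using uv that unfolding V1_def by auto
      then have *: "f1 u v \<ge> 0 \<and> f1 u v + f1 v u = contract_mult A a m u v" using f1(1) unfolding orients_def by auto
      have "contract_mult A a m u v = (if u = v then 0 else m u v)" using that A by (auto simp: contract_mult_def block_def)
      then show ?thesis using * m(3) by auto
    qed
    then show "0 \<le> f u v \<and> f u v + f v u = m u v"
      using f2(1) g[of u v] g[of v u] m(1)[of u v] m(2) uv unfolding orients_def f_def by auto
  qed
  moreover have "2 * k dvd net V f v - b v" if v: "v \<in> V" for v
  proof (cases "v \<in> A")
    case True
    have "net V f v = (\<Sum>u\<in>A. f v u - f u v) + (\<Sum>u\<in>V - A. f v u - f u v)"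
      unfolding net_def using sum.subset_diff[OF A(1) fin] by (simp add: add.commute)
    also have "(\<Sum>u\<in>A. f v u - f u v) = net A f2 v"
      unfolding net_def using True by (intro sum.cong) (auto simp: f_def)
    also have "(\<Sum>u\<in>V - A. f v u - f u v) = (\<Sum>u\<in>V - A. 2 * g v u - m v u)"
      using True m(1) by (intro sum.cong) (auto simp: f_def)
    finally show ?thesis using f2(2)[OF True] by (simp add: algebra_simps)
  next
    case False
    then have vA: "v \<in> V - A" "v \<in> V1" "v \<noteq> a" using v A unfolding V1_def by auto
    have "net V f v = (\<Sum>u\<in>A. f v u - f u v) + (\<Sum>u\<in>V - A. f v u - f u v)"
      unfolding net_def using sum.subset_diff[OF A(1) fin] by (simp add: add.commute)
    also have "(\<Sum>u\<in>A. f v u - f u v) = (\<Sum>u\<in>A. m u v - 2 * g u v)"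
      using False m(1)[of v] by (intro sum.cong) (auto simp: f_def)
    also have "\<dots> = f1 v a - f1 a v"
      using gs[OF vA(1)] f1a[OF vA(1)] by (simp add: sum_subtractf sum_distrib_left[symmetric])
    also have "(\<Sum>u\<in>V - A. f v u - f u v) = (\<Sum>u\<in>V - A. f1 v u - f1 u v)"
      using False by (intro sum.cong) (auto simp: f_def)
    finally have "net V f v = net V1 f1 v" unfolding net_def V1_def using fin A by simp
    then show ?thesis using f1(2)[OF vA(2)] vA(3) by (simp add: block_def)
  qed
  ultimately show ?thesis unfolding solvable_def by blast
qed

section \<open>The inductive hypothesis and its behaviour under contraction\<close>

text \<open>The vertex z, if it lies in V, is exempt from the cut condition for the singleton; its edges are
  lifted one pair at a time until it is isolated.\<close>

locale certificate =
  fixes k :: int and V :: "'a set" and m :: "'a \<Rightarrow> 'a \<Rightarrow> int" and b p q :: "'a \<Rightarrow> int" and z :: 'a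
  assumes finite_V: "finite V"
    and m_commute: "m u v = m v u"
    and m_nonneg: "0 \<le> m u v"
    and m_irrefl: "m v v = 0"
    and p_nonneg: "v \<in> V \<Longrightarrow> 0 \<le> p v" and q_nonneg: "v \<in> V \<Longrightarrow> 0 \<le> q v"
    and parity: "v \<in> V \<Longrightarrow> even ((\<Sum>u\<in>V. m v u) + b v)"
    and balanced: "2 * k dvd sum b V"
    and cut_ge: "A \<noteq> {} \<Longrightarrow> A \<subset> V \<Longrightarrow> A \<noteq> {z} \<Longrightarrow>
      2 * k - 2 + mod_norm k (demand b p q A) \<le> cut_deg V m p q A"
    and root_le: "cut_deg V m p q V \<le> 2 * k - 2 + mod_norm k (demand b p q V)"
    and exempt: "z \<in> V \<Longrightarrow> 2 * k dvd demand b p q {z}"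

text \<open>The first component of the termination measure. Every edge is counted twice, so
  orienting or lifting lowers it by two.\<close>

definition esize :: "'a set \<Rightarrow> ('a \<Rightarrow> 'a \<Rightarrow> int) \<Rightarrow> nat" where
  "esize V m = card V + nat (\<Sum>u\<in>V. \<Sum>v\<in>V. m u v)"

context certificate
begin

lemma even_cut:
  assumes "A \<subseteq> V" shows "even ((\<Sum>u\<in>A. \<Sum>v\<in>V - A. m u v) + sum b A)"
proof -
  have fin: "finite A" using assms finite_V finite_subset by auto
  have "even (\<Sum>u\<in>A. (\<Sum>v\<in>V. m u v) + b u)" using parity assms by (intro dvd_sum) auto
  moreover have "(\<Sum>v\<in>V. m u v) = (\<Sum>v\<in>V - A. m u v) + (\<Sum>v\<in>A. m u v)" for u
    using sum.subset_diff[OF assms finite_V] by auto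
  ultimately have "even ((\<Sum>u\<in>A. \<Sum>v\<in>V - A. m u v) + (\<Sum>u\<in>A. \<Sum>v\<in>A. m u v) + sum b A)"
    by (simp add: sum.distrib)
  moreover have "even (\<Sum>u\<in>A. \<Sum>v\<in>A. m u v)"
    by (rule even_sum_symmetric[OF fin]) (auto simp: m_commute m_irrefl)
  ultimately show ?thesis by simp
qed

text \<open>Together with \<open>even_mod_norm\<close> this makes the excess of every cut over its
  required bound even: a cut is tight or has two edges to spare.\<close>

lemma even_deg_dem:
  assumes "A \<subseteq> V" shows "even (cut_deg V m p q A + demand b p q A)"
proof -
  have "cut_deg V m p q A + demand b p q A = (\<Sum>u\<in>A. \<Sum>v\<in>V - A. m u v) + sum b A + 2 * sum q A"
    by (simp add: cut_deg_def demand_def)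
  then show ?thesis using even_cut[OF assms] by simp
qed

text \<open>The cuts of the contracted graph are the cuts of the original one that do not split A,
  so all bounds are inherited. The representative a differs from z so that no contracted set
  inherits the exemption: z stays a vertex of its own or disappears inside A.\<close>

lemma contract:
  assumes A: "A \<subseteq> V" "a \<in> A" "a \<noteq> z"
  shows "certificate k (insert a (V - A)) (contract_mult A a m) (\<lambda>v. sum b (block A a v))
     (\<lambda>v. sum p (block A a v)) (\<lambda>v. sum q (block A a v)) z" (is "certificate k ?V1 ?m ?b ?p ?q z")
    and "card A \<ge> 2 \<Longrightarrow> esize (insert a (V - A)) (contract_mult A a m) < esize V m"
proof -
  have finA: "finite A" using A finite_V finite_subset by auto
  have fin1: "finite ?V1" using finite_V by simp
  have fcl: "finite (block A a u)" for u using finA by (simp add: block_def)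
  \<comment> \<open>The set of original vertices represented by B.\<close>
  define hat where "hat B = (\<Union>u\<in>B. block A a u)" for B
  have disj: "block A a u \<inter> block A a v = {}" if "u \<in> ?V1" "v \<in> ?V1" "u \<noteq> v" for u v
    using that by (auto simp: block_def)
  have sum_hat: "(\<Sum>u\<in>B. sum g (block A a u)) = sum g (hat B)" if "B \<subseteq> ?V1" for B and g :: "'a \<Rightarrow> int"
    unfolding hat_def
  proof (rule sum.UNION_disjoint[symmetric])
    show "finite B" using that fin1 by (rule finite_subset)
    show "\<forall>u\<in>B. finite (block A a u)" using fcl by simp
    show "\<forall>u\<in>B. \<forall>v\<in>B. u \<noteq> v \<longrightarrow> block A a u \<inter> block A a v = {}" using disj that by blast
  qed
  have hatV: "hat ?V1 = V" unfolding hat_def block_def using A by auto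
  have hat_diff: "hat (?V1 - B) = V - hat B" if "B \<subseteq> ?V1" for B
    using that A unfolding hat_def block_def by (auto split: if_splits)
  have m1: "?m u v = (\<Sum>u'\<in>block A a u. \<Sum>v'\<in>block A a v. m u' v')" if "u \<noteq> v" for u v
    using that by (simp add: contract_mult_def)
  have cut: "(\<Sum>u\<in>B. \<Sum>v\<in>?V1 - B. ?m u v) = (\<Sum>u\<in>hat B. \<Sum>v\<in>V - hat B. m u v)" if "B \<subseteq> ?V1" for B
  proof -
    have "(\<Sum>u\<in>B. \<Sum>v\<in>?V1 - B. ?m u v)
        = (\<Sum>u\<in>B. \<Sum>v\<in>?V1 - B. \<Sum>u'\<in>block A a u. \<Sum>v'\<in>block A a v. m u' v')"
      by (intro sum.cong refl m1) auto
    also have "\<dots> = (\<Sum>u\<in>B. \<Sum>u'\<in>block A a u. \<Sum>v\<in>?V1 - B. \<Sum>v'\<in>block A a v. m u' v')"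
      by (intro sum.cong refl sum.swap)
    also have "\<dots> = (\<Sum>u\<in>hat B. \<Sum>v\<in>hat (?V1 - B). m u v)"
      using that by (simp add: sum_hat del: Diff_insert)
    finally show ?thesis using hat_diff[OF that] by simp
  qed
  have deg1: "cut_deg ?V1 ?m ?p ?q B = cut_deg V m p q (hat B)" if "B \<subseteq> ?V1" for B
    unfolding cut_deg_def using cut[OF that] sum_hat[OF that] by simp
  have dem1: "demand ?b ?p ?q B = demand b p q (hat B)" if "B \<subseteq> ?V1" for B
    unfolding demand_def using sum_hat[OF that] by simp
  have hat_single: "hat {v} = block A a v" for v by (simp add: hat_def)
  show "certificate k ?V1 ?m ?b ?p ?q z"
  proof
    show "finite ?V1" by (rule fin1)
    show "?m u v = ?m v u" for u v
    proof -
      have "(\<Sum>u'\<in>block A a u. \<Sum>v'\<in>block A a v. m u' v') = (\<Sum>v'\<in>block A a v. \<Sum>u'\<in>block A a u. m u' v')"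
        by (rule sum.swap)
      also have "\<dots> = (\<Sum>v'\<in>block A a v. \<Sum>u'\<in>block A a u. m v' u')"
        using m_commute by (intro sum.cong refl) auto
      finally show ?thesis unfolding contract_mult_def by simp
    qed
    show "0 \<le> ?m u v" for u v unfolding contract_mult_def using m_nonneg by (simp add: sum_nonneg)
    show "?m v v = 0" for v by (simp add: contract_mult_def)
    show "0 \<le> ?p v" "0 \<le> ?q v" if "v \<in> ?V1" for v
      using that A p_nonneg q_nonneg by (auto intro!: sum_nonneg simp: block_def split: if_splits)
    show "even ((\<Sum>u\<in>?V1. ?m v u) + ?b v)" if v: "v \<in> ?V1" for v
    proof -
      have "(\<Sum>u\<in>?V1. ?m v u) = (\<Sum>u\<in>{v}. \<Sum>w\<in>?V1 - {v}. ?m u w)"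
        using sum.remove[OF fin1 v, of "?m v"] by (simp add: contract_mult_def)
      also have "\<dots> = (\<Sum>u\<in>block A a v. \<Sum>w\<in>V - block A a v. m u w)"
        using cut[of "{v}"] v by (simp add: hat_single del: Diff_insert)
      finally show ?thesis using even_cut[of "block A a v"] v A by (auto simp: block_def split: if_splits)
    qed
    show "2 * k dvd sum ?b ?V1" using sum_hat[of ?V1 b] hatV balanced by simp
    show "2 * k - 2 + mod_norm k (demand ?b ?p ?q B) \<le> cut_deg ?V1 ?m ?p ?q B"
      if B: "B \<noteq> {}" "B \<subset> ?V1" "B \<noteq> {z}" for B
    proof -
      have "hat B \<noteq> {}" using B A unfolding hat_def block_def by auto
      moreover have "hat B \<subset> V"
      proof -
        have "hat (?V1 - B) \<noteq> {}" using B A unfolding hat_def block_def by auto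
        then have "V - hat B \<noteq> {}" using hat_diff[of B] B by blast
        moreover have "hat B \<subseteq> hat ?V1" unfolding hat_def using B by blast
        ultimately show ?thesis using hatV by blast
      qed
      moreover have "hat B \<noteq> {z}"
      proof (cases "a \<in> B")
        case True then have "a \<in> hat B" using A unfolding hat_def block_def by auto
        then show ?thesis using A by auto
      next
        case False then have "hat B = B" unfolding hat_def block_def by auto
        then show ?thesis using B by simp
      qed
      ultimately show ?thesis using cut_ge deg1 dem1 B by simp
    qed
    show "cut_deg ?V1 ?m ?p ?q ?V1 \<le> 2 * k - 2 + mod_norm k (demand ?b ?p ?q ?V1)"
      using deg1[of ?V1] dem1[of ?V1] hatV root_le by simp
    show "2 * k dvd demand ?b ?p ?q {z}" if "z \<in> ?V1"
      using that A exempt dem1[of "{z}"] by (simp add: hat_single block_def)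
  qed
  show "esize ?V1 ?m < esize V m" if c: "card A \<ge> 2"
  proof -
    have "(\<Sum>u\<in>?V1. \<Sum>v\<in>?V1. ?m u v)
        \<le> (\<Sum>u\<in>?V1. \<Sum>v\<in>?V1. \<Sum>u'\<in>block A a u. \<Sum>v'\<in>block A a v. m u' v')"
      unfolding contract_mult_def using m_nonneg by (intro sum_mono) (auto intro!: sum_nonneg)
    also have "\<dots> = (\<Sum>u\<in>?V1. \<Sum>u'\<in>block A a u. \<Sum>v\<in>?V1. \<Sum>v'\<in>block A a v. m u' v')"
      by (intro sum.cong refl sum.swap)
    also have "\<dots> = (\<Sum>u\<in>V. \<Sum>v\<in>V. m u v)" by (simp add: sum_hat hatV)
    finally have "nat (\<Sum>u\<in>?V1. \<Sum>v\<in>?V1. ?m u v) \<le> nat (\<Sum>u\<in>V. \<Sum>v\<in>V. m u v)" by simp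
    moreover have "card ?V1 < card V"
      using c A finA finite_V card_mono[OF finite_V A(1)] by (simp add: card_Diff_subset)
    ultimately show ?thesis unfolding esize_def by linarith
  qed
qed

text \<open>Here V - A is merged into the special vertex: boundary edges directed into A are added
  to p, those directed out of A to q, and b is corrected accordingly. Degrees and demands of subsets
  of A do not change, and the tightness of A turns into \<open>root_le\<close>.\<close>

lemma inner:
  assumes A: "A \<subset> V" "A \<noteq> {}"
    and tight: "cut_deg V m p q A \<le> 2 * k - 2 + mod_norm k (demand b p q A)"
    and g: "\<And>w v. w \<in> A \<Longrightarrow> v \<in> V - A \<Longrightarrow> 0 \<le> g w v \<and> g w v \<le> m w v"
    and bal: "2 * k dvd (\<Sum>w\<in>A. b w - (\<Sum>v\<in>V - A. 2 * g w v - m w v))"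
  shows "certificate k A m (\<lambda>w. b w - (\<Sum>v\<in>V - A. 2 * g w v - m w v))
     (\<lambda>w. p w + (\<Sum>v\<in>V - A. m w v - g w v)) (\<lambda>w. q w + (\<Sum>v\<in>V - A. g w v)) z"
    (is "certificate k A m ?b ?p ?q z")
    and "esize A m < esize V m"
proof -
  have finA: "finite A" using A finite_V finite_subset by auto
  have dem1: "demand ?b ?p ?q B = demand b p q B" for B
    unfolding demand_def by (simp add: sum.distrib sum_subtractf sum_distrib_left[symmetric])
  have deg1: "cut_deg A m ?p ?q B = cut_deg V m p q B" if "B \<subseteq> A" for B
  proof -
    have "V - B = (A - B) \<union> (V - A)" "(A - B) \<inter> (V - A) = {}" using that A by auto
    then have "(\<Sum>v\<in>V - B. m u v) = (\<Sum>v\<in>A - B. m u v) + (\<Sum>v\<in>V - A. m u v)" for u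
      using finA finite_V by (simp add: sum.union_disjoint)
    then show ?thesis unfolding cut_deg_def by (simp add: sum.distrib sum_subtractf)
  qed
  show "certificate k A m ?b ?p ?q z"
  proof
    show "0 \<le> ?p v" "0 \<le> ?q v" if "v \<in> A" for v
      using g[OF that] p_nonneg[of v] q_nonneg[of v] that A
      by (auto intro!: add_nonneg_nonneg sum_nonneg)
    show "even ((\<Sum>u\<in>A. m v u) + ?b v)" if "v \<in> A" for v
    proof -
      have "(\<Sum>u\<in>V. m v u) = (\<Sum>u\<in>V - A. m v u) + (\<Sum>u\<in>A. m v u)"
        using sum.subset_diff[OF _ finite_V] A by auto
      then have "(\<Sum>u\<in>A. m v u) + ?b v = ((\<Sum>u\<in>V. m v u) + b v) - 2 * (\<Sum>u\<in>V - A. g v u)"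
        by (simp add: sum_subtractf sum_distrib_left)
      moreover have "even ((\<Sum>u\<in>V. m v u) + b v)" using parity[of v] that A by auto
      ultimately show ?thesis by (metis dvd_diff dvd_triv_left)
    qed
    show "2 * k - 2 + mod_norm k (demand ?b ?p ?q B) \<le> cut_deg A m ?p ?q B"
      if B: "B \<noteq> {}" "B \<subset> A" "B \<noteq> {z}" for B
      using cut_ge[of B] B A deg1[of B] dem1 by auto
    show "cut_deg A m ?p ?q A \<le> 2 * k - 2 + mod_norm k (demand ?b ?p ?q A)"
      using tight deg1[of A] dem1 by simp
    show "2 * k dvd demand ?b ?p ?q {z}" if "z \<in> A"
      using that A exempt dem1 by auto
  qed (use finA m_commute m_nonneg m_irrefl bal in auto)
  have "(\<Sum>u\<in>A. \<Sum>v\<in>A. m u v) \<le> (\<Sum>u\<in>A. \<Sum>v\<in>V. m u v)"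
    using A m_nonneg finite_V by (intro sum_mono sum_mono2) auto
  also have "\<dots> \<le> (\<Sum>u\<in>V. \<Sum>v\<in>V. m u v)"
    using A m_nonneg finite_V by (intro sum_mono2) (auto intro!: sum_nonneg)
  finally have "nat (\<Sum>u\<in>A. \<Sum>v\<in>A. m u v) \<le> nat (\<Sum>u\<in>V. \<Sum>v\<in>V. m u v)" by simp
  moreover have "card A < card V" using A finite_V by (simp add: psubset_card_mono)
  ultimately show "esize A m < esize V m" unfolding esize_def by linarith
qed

end

section \<open>Reductions in a minimal counterexample\<close>

lemma solvable_pair:
  assumes "x \<noteq> u" "\<And>u v. m u v = m v u" "\<And>v. m v v = 0"
    and "0 \<le> s" "s \<le> m x u" "2 * k dvd 2 * s - m x u - c x" "2 * k dvd c x + c u"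
  shows "solvable k {x, u} m c"
proof -
  define f where "f v w = (if v = x \<and> w = u then s else if v = u \<and> w = x then m x u - s else 0)" for v w
  have "orients {x, u} m f" using assms by (auto simp: orients_def f_def)
  moreover have "net {x, u} f x = 2 * s - m x u" "net {x, u} f u = m x u - 2 * s"
    using assms(1) by (auto simp: net_def f_def)
  moreover have "2 * k dvd m x u - 2 * s - c u"
  proof -
    have "m x u - 2 * s - c u = - (2 * s - m x u - c x) - (c x + c u)" by simp
    then show ?thesis using assms(6,7) by (metis dvd_diff dvd_minus_iff)
  qed
  ultimately show ?thesis unfolding solvable_def using assms(6) by auto
qed

text \<open>A counterexample that is minimal in the lexicographic order of \<open>esize\<close> and
  the number of special edges. The second component serves the one reduction that deletes nothing
  but a special edge.\<close>

locale stuck = certificate k V m b p q z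
  for k :: int and V :: "'a set" and m b p q z +
  assumes k2: "2 \<le> k"
    and IH: "certificate k (V' :: 'a set) m' b' p' q' z' \<Longrightarrow>
      esize V' m' < esize V m \<or>
      esize V' m' = esize V m \<and> sum p' V' + sum q' V' < sum p V + sum q V \<Longrightarrow> solvable k V' m' b'"
    and unsolvable: "\<not> solvable k V m b"
begin

lemma k_pos: "0 < k" using k2 by simp

lemma card_ge: "2 \<le> card V"
proof (rule ccontr)
  assume "\<not> 2 \<le> card V"
  then have "card V = 0 \<or> card V = 1" by linarith
  then have "V = {} \<or> (\<exists>v. V = {v})" using finite_V by (auto simp: card_1_singleton_iff)
  then have "solvable k V m b"
  proof
    assume "\<exists>v. V = {v}"
    then obtain v where v: "V = {v}" by blast
    then have "2 * k dvd 0 - b v" using balanced by simp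
    then show ?thesis unfolding solvable_def v orients_def net_def
      using m_irrefl by (intro exI[of _ "\<lambda>_ _. 0"]) simp
  qed (simp add: solvable_def orients_def)
  then show False using unsolvable by simp
qed

text \<open>Otherwise parity makes A tight. Then both the graph with A contracted and the graph
  inside A are smaller certificates, and their solutions combine.\<close>

lemma slack:
  assumes A: "A \<subset> V" "2 \<le> card A"
  shows "2 * k + mod_norm k (demand b p q A) \<le> cut_deg V m p q A"
proof (rule ccontr)
  assume *: "\<not> ?thesis"
  have fA: "finite A" using A finite_V finite_subset by auto
  have ne: "A \<noteq> {}" "A \<noteq> {z}" using A by auto
  have "2 * k - 2 + mod_norm k (demand b p q A) \<le> cut_deg V m p q A" using cut_ge ne A by blast
  moreover have "even (cut_deg V m p q A + demand b p q A)" using A even_deg_dem by blast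
  moreover have "even (mod_norm k (demand b p q A) + demand b p q A)" by (rule even_mod_norm[OF k_pos])
  ultimately have "cut_deg V m p q A = 2 * k - 1 + mod_norm k (demand b p q A) \<Longrightarrow> False"
    by simp
  then have tight: "cut_deg V m p q A \<le> 2 * k - 2 + mod_norm k (demand b p q A)"
    using * \<open>2 * k - 2 + mod_norm k (demand b p q A) \<le> cut_deg V m p q A\<close> by (smt (verit))
  obtain a where a: "a \<in> A" "a \<noteq> z"
    using ne by blast
  have "solvable k V m b"
  proof (rule solvable_contract[OF finite_V _ a(1)])
    show "solvable k (insert a (V - A)) (contract_mult A a m) (\<lambda>v. sum b (block A a v))"
      by (rule IH[OF contract(1)]) (use contract(2)[of A a] a A in auto)
    show "solvable k A m (\<lambda>w. b w - (\<Sum>v\<in>V - A. 2 * g w v - m w v))"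
      if "\<And>w v. w \<in> A \<Longrightarrow> v \<in> V - A \<Longrightarrow> 0 \<le> g w v \<and> g w v \<le> m w v"
        "2 * k dvd (\<Sum>w\<in>A. b w - (\<Sum>v\<in>V - A. 2 * g w v - m w v))" for g
      by (rule IH[OF inner(1)[OF A(1) ne(1) tight that]]) (use inner(2)[OF A(1) ne(1) tight that] in auto)
  qed (use A m_commute m_nonneg m_irrefl in auto)
  then show False using unsolvable by simp
qed

text \<open>A set of two vertices can be contracted without being tight, because the problem inside
  concerns only one bundle of parallel edges. Here c stands for the demand left over by an unknown
  outer solution; the premises of s collect what is certain about it: balance, parity, and that
  nothing changes at x if x has no neighbour but u.\<close>

lemma solvable_contract_pair:
  assumes xu: "x \<in> V" "u \<in> V" "x \<noteq> u"
    and s: "\<And>c. 2 * k dvd c x + c u \<Longrightarrow> even (m x u + c x) \<Longrightarrow>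
       ((\<And>v. v \<in> V - {x, u} \<Longrightarrow> m x v = 0) \<Longrightarrow> c x = b x) \<Longrightarrow>
       \<exists>s. 0 \<le> s \<and> s \<le> m x u \<and> 2 * k dvd 2 * s - m x u - c x"
  shows False
proof -
  obtain a where a: "a \<in> {x, u}" "a \<noteq> z" using xu by blast
  have "solvable k V m b"
  proof (rule solvable_contract[OF finite_V _ a(1)])
    show "solvable k (insert a (V - {x, u})) (contract_mult {x, u} a m) (\<lambda>v. sum b (block {x, u} a v))"
      by (rule IH[OF contract(1)]) (use contract(2)[of "{x, u}" a] a xu in auto)
    fix g assume g: "\<And>w v. w \<in> {x, u} \<Longrightarrow> v \<in> V - {x, u} \<Longrightarrow> 0 \<le> g w v \<and> g w v \<le> m w v"
      and bal: "2 * k dvd (\<Sum>w\<in>{x, u}. b w - (\<Sum>v\<in>V - {x, u}. 2 * g w v - m w v))"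
    define c where "c w = b w - (\<Sum>v\<in>V - {x, u}. 2 * g w v - m w v)" for w
    have 1: "2 * k dvd c x + c u" using bal xu unfolding c_def by simp
    have "(\<Sum>v\<in>V. m x v) = (\<Sum>v\<in>V - {x, u}. m x v) + (\<Sum>v\<in>{x, u}. m x v)"
      using xu by (intro sum.subset_diff finite_V) auto
    then have "m x u + c x = ((\<Sum>v\<in>V. m x v) + b x) - 2 * (\<Sum>v\<in>V - {x, u}. g x v)"
      using xu m_irrefl by (simp add: c_def sum_subtractf sum_distrib_left)
    then have 2: "even (m x u + c x)" using parity[OF xu(1)] by (metis dvd_diff dvd_triv_left)
    have 3: "c x = b x" if nb: "\<And>v. v \<in> V - {x, u} \<Longrightarrow> m x v = 0"
    proof -
      have "2 * g x v - m x v = 0" if v: "v \<in> V - {x, u}" for v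
        using g[of x v] v nb[OF v] by auto
      then have "(\<Sum>v\<in>V - {x, u}. 2 * g x v - m x v) = 0" by (intro sum.neutral) blast
      then show ?thesis unfolding c_def by simp
    qed
    obtain h where "0 \<le> h" "h \<le> m x u" "2 * k dvd 2 * h - m x u - c x"
      using s[OF 1 2 3] by blast
    then have "solvable k {x, u} m c"
      using xu 1 m_commute m_irrefl by (intro solvable_pair[where s = h]) auto
    then show "solvable k {x, u} m (\<lambda>w. b w - (\<Sum>v\<in>V - {x, u}. 2 * g w v - m w v))"
      unfolding c_def .
  qed (use xu m_commute m_nonneg m_irrefl in auto)
  then show False using unsolvable by simp
qed

text \<open>With at least k - 1 parallel edges the number directed from x to u can be any of 0, ...,
  k - 1, and the resulting net flows cover every residue modulo 2k of the right parity.\<close>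

lemma mult_small:
  assumes xu: "x \<in> V" "u \<in> V" "x \<noteq> u" shows "m x u \<le> k - 2"
proof (rule ccontr)
  assume *: "\<not> ?thesis"
  show False
  proof (rule solvable_contract_pair[OF xu])
    fix c :: "'a \<Rightarrow> int" assume "even (m x u + c x)"
    then obtain h where h: "m x u + c x = 2 * h" by blast
    have "2 * (h mod k) - m x u - c x = 2 * k * (- (h div k))"
      using h minus_mult_div_eq_mod[of h k, symmetric] by (simp add: right_diff_distrib)
    moreover have "0 \<le> h mod k" "h mod k < k" using k_pos by auto
    ultimately show "\<exists>s. 0 \<le> s \<and> s \<le> m x u \<and> 2 * k dvd 2 * s - m x u - c x"
      using * by (intro exI[of _ "h mod k"]) auto
  qed
qed

text \<open>The demand of z is a multiple of 2k, so by parity its edges to u are even in number and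
  half of them can be directed each way.\<close>

lemma exempt_not_pendant:
  assumes z: "z \<in> V" "p z = 0" "q z = 0" and u: "u \<in> V" "u \<noteq> z"
    and nb: "\<And>v. v \<in> V - {z, u} \<Longrightarrow> m z v = 0"
  shows False
proof (rule solvable_contract_pair[OF z(1) u(1) u(2)[symmetric]])
  fix c :: "'a \<Rightarrow> int" assume e: "even (m z u + c z)"
    and "(\<And>v. v \<in> V - {z, u} \<Longrightarrow> m z v = 0) \<Longrightarrow> c z = b z"
  then have cz: "c z = b z" using nb by blast
  have dv: "2 * k dvd c z" using exempt[OF z(1)] z cz by (simp add: demand_def)
  then have "even (m z u)" using e by (metis dvd_add_left_iff dvd_mult_left)
  then obtain h where "m z u = 2 * h" by blast
  then show "\<exists>s. 0 \<le> s \<and> s \<le> m z u \<and> 2 * k dvd 2 * s - m z u - c z"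
    using dv m_nonneg[of z u] by (intro exI[of _ h]) auto
qed

text \<open>The edge xy is directed from x to y and deleted. The special edges and the exempt vertex
  may be replaced at the same time, since balance and parity do not mention them and
  \<open>esize\<close> decreases in any case.\<close>

lemma orient_step:
  assumes xy: "x \<in> V" "y \<in> V" "x \<noteq> y" "1 \<le> m x y"
    and nonneg: "\<And>v. v \<in> V \<Longrightarrow> 0 \<le> p' v" "\<And>v. v \<in> V \<Longrightarrow> 0 \<le> q' v"
    and cut: "\<And>A. A \<noteq> {} \<Longrightarrow> A \<subset> V \<Longrightarrow> A \<noteq> {z'} \<Longrightarrow>
       2 * k - 2 + mod_norm k (demand b p' q' A - (if x \<in> A then 1 else 0) + (if y \<in> A then 1 else 0))
         \<le> cut_deg V m p' q' A - (if (x \<in> A) \<noteq> (y \<in> A) then 1 else 0)"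
    and root: "cut_deg V m p' q' V \<le> 2 * k - 2 + mod_norm k (demand b p' q' V)"
    and ex: "z' \<in> V \<Longrightarrow> 2 * k dvd demand b p' q' {z'} - (if x = z' then 1 else 0) + (if y = z' then 1 else 0)"
  shows False
proof -
  let ?m = "\<lambda>u v. m u v - edge x y u v" and ?b = "\<lambda>v. b v - point x v + point y v"
  have dem1: "demand ?b p' q' A = demand b p' q' A - (if x \<in> A then 1 else 0) + (if y \<in> A then 1 else 0)"
    if "A \<subseteq> V" for A
    using finite_subset[OF that finite_V] by (simp add: demand_def sum.distrib sum_subtractf sum_point)
  have deg1: "cut_deg V ?m p' q' A = cut_deg V m p' q' A - (if (x \<in> A) \<noteq> (y \<in> A) then 1 else 0)"
    if "A \<subseteq> V" for A
    using finite_subset[OF that finite_V] finite_V that xy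
    by (auto simp: cut_deg_def sum_subtractf sum_edge)
  have cert: "certificate k V ?m ?b p' q' z'"
  proof
    show "?m u v = ?m v u" for u v using m_commute[of u v] edge_commute[of x y] by simp
    show "0 \<le> ?m u v" for u v using m_nonneg[of u v] xy m_commute[of x y] by (auto simp: edge_def point_def)
    show "?m v v = 0" for v using m_irrefl xy by (auto simp: edge_def point_def)
    show "even ((\<Sum>u\<in>V. ?m v u) + ?b v)" if "v \<in> V" for v
    proof -
      have "(\<Sum>u\<in>V. ?m v u) + ?b v = (\<Sum>u\<in>V. m v u) + b v - 2 * point x v"
        using xy finite_V by (simp add: sum_subtractf sum_edge_row)
      then show ?thesis using parity[OF that] by (metis dvd_diff dvd_triv_left)
    qed
    show "2 * k dvd sum ?b V" using balanced xy finite_V by (simp add: sum.distrib sum_subtractf sum_point)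
  qed (use finite_V nonneg cut root ex dem1 deg1 xy in auto)
  have "(\<Sum>u\<in>V. \<Sum>v\<in>V. ?m u v) = (\<Sum>u\<in>V. \<Sum>v\<in>V. m u v) - 2"
    using xy finite_V by (simp add: sum_subtractf sum_edge)
  moreover have "(\<Sum>u\<in>V. \<Sum>v\<in>V. m u v) \<ge> m x y"
  proof -
    have "m x y \<le> (\<Sum>v\<in>V. m x v)" using xy finite_V m_nonneg by (intro member_le_sum) auto
    also have "\<dots> \<le> (\<Sum>u\<in>V. \<Sum>v\<in>V. m u v)"
      using xy finite_V m_nonneg by (intro member_le_sum[of x V "\<lambda>u. \<Sum>v\<in>V. m u v"]) (auto intro!: sum_nonneg)
    finally show ?thesis .
  qed
  ultimately have "solvable k V ?m ?b" using xy by (intro IH[OF cert]) (auto simp: esize_def)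
  then show False using solvable_orient_edge[OF finite_V xy(1-3)] unsolvable by blast
qed

text \<open>Replacing xy and xw by yw costs a cut two edges exactly when it separates x from both y
  and w, and leaves all demands alone.\<close>

lemma lift_step:
  assumes xyw: "x \<in> V" "y \<in> V" "w \<in> V" "x \<noteq> y" "x \<noteq> w" "y \<noteq> w" "1 \<le> m x y" "1 \<le> m x w"
    and cut: "\<And>A. A \<noteq> {} \<Longrightarrow> A \<subset> V \<Longrightarrow> A \<noteq> {z'} \<Longrightarrow>
       2 * k - 2 + mod_norm k (demand b p q A) \<le> cut_deg V m p q A -
         (if (x \<in> A) \<noteq> (y \<in> A) \<and> (x \<in> A) \<noteq> (w \<in> A) then 2 else 0)"
    and ex: "z' \<in> V \<Longrightarrow> 2 * k dvd demand b p q {z'}"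
  shows False
proof -
  let ?m = "\<lambda>u v. m u v - edge x y u v - edge x w u v + edge y w u v"
  have deg1: "cut_deg V ?m p q A = cut_deg V m p q A -
      (if (x \<in> A) \<noteq> (y \<in> A) \<and> (x \<in> A) \<noteq> (w \<in> A) then 2 else 0)"
    if "A \<subseteq> V" for A
  proof -
    have fA: "finite A" by (rule finite_subset[OF that finite_V])
    have "cut_deg V ?m p q A = cut_deg V m p q A - (\<Sum>u\<in>A. \<Sum>v\<in>V - A. edge x y u v)
       - (\<Sum>u\<in>A. \<Sum>v\<in>V - A. edge x w u v) + (\<Sum>u\<in>A. \<Sum>v\<in>V - A. edge y w u v)"
      by (simp add: cut_deg_def sum_subtractf sum.distrib)
    then show ?thesis using fA finite_V xyw(1-3)
      by (cases "x \<in> A"; cases "y \<in> A"; cases "w \<in> A"; simp add: sum_edge)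
  qed
  have cert: "certificate k V ?m b p q z'"
  proof
    show "?m u v = ?m v u" for u v using m_commute[of u v] edge_commute[of _ _ u v] by simp
    show "0 \<le> ?m u v" for u v
    proof -
      have "1 \<le> m y x" "1 \<le> m w x" using xyw m_commute by auto
      then show ?thesis using xyw(4-8) by (simp add: edge_def point_def m_nonneg add_nonneg_nonneg)
    qed
    show "?m v v = 0" for v using m_irrefl xyw by (auto simp: edge_def point_def)
    show "even ((\<Sum>u\<in>V. ?m v u) + b v)" if "v \<in> V" for v
    proof -
      have "(\<Sum>u\<in>V. ?m v u) + b v = (\<Sum>u\<in>V. m v u) + b v - 2 * point x v"
        using xyw finite_V by (simp add: sum_subtractf sum.distrib sum_edge_row)
      then show ?thesis using parity[OF that] by (metis dvd_diff dvd_triv_left)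
    qed
    show "cut_deg V ?m p q V \<le> 2 * k - 2 + mod_norm k (demand b p q V)" using root_le deg1[of V] xyw by simp
    show "2 * k - 2 + mod_norm k (demand b p q A) \<le> cut_deg V ?m p q A"
      if "A \<noteq> {}" "A \<subset> V" "A \<noteq> {z'}" for A
      using cut[OF that] deg1[of A] that(2) by simp
  qed (fact finite_V p_nonneg q_nonneg balanced ex)+
  have "(\<Sum>u\<in>V. \<Sum>v\<in>V. ?m u v) = (\<Sum>u\<in>V. \<Sum>v\<in>V. m u v) - 2"
    using xyw finite_V by (simp add: sum_subtractf sum.distrib sum_edge)
  moreover have "(\<Sum>u\<in>V. \<Sum>v\<in>V. m u v) \<ge> m x y"
  proof -
    have "m x y \<le> (\<Sum>v\<in>V. m x v)" using xyw finite_V m_nonneg by (intro member_le_sum) auto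
    also have "\<dots> \<le> (\<Sum>u\<in>V. \<Sum>v\<in>V. m u v)"
      using xyw finite_V m_nonneg by (intro member_le_sum[of x V "\<lambda>u. \<Sum>v\<in>V. m u v"]) (auto intro!: sum_nonneg)
    finally show ?thesis .
  qed
  ultimately have "solvable k V ?m b" using xyw by (intro IH[OF cert]) (auto simp: esize_def)
  then show False using solvable_lift[OF finite_V xyw(1-6)] m_nonneg unsolvable by blast
qed

end

context stuck
begin

lemma proper_singletonE:
  assumes "A \<noteq> {}" "A \<subset> V" "\<not> 2 \<le> card A" obtains v where "A = {v}" "v \<in> V"
proof -
  have "finite A" using assms finite_V finite_subset by auto
  then have "card A \<noteq> 0" using assms by simp
  then have "card A = 1" using assms by linarith
  then show ?thesis using that assms(2) by (auto simp: card_1_singleton_iff)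
qed

lemma single_proper: "v \<in> V \<Longrightarrow> {v} \<subset> V"
  using card_ge by fastforce

lemma deg_complement:
  assumes "A \<subseteq> V"
  shows "cut_deg V m p q A + cut_deg V m p q (V - A) = cut_deg V m p q V + 2 * (\<Sum>u\<in>A. \<Sum>v\<in>V - A. m u v)"
    and "demand b p q V = demand b p q A + demand b p q (V - A)"
proof -
  have VA: "V - (V - A) = A" using assms by auto
  have "(\<Sum>u\<in>V - A. \<Sum>v\<in>A. m u v) = (\<Sum>u\<in>A. \<Sum>v\<in>V - A. m u v)"
    using sum.swap[of m A "V - A"] m_commute by simp
  then show "cut_deg V m p q A + cut_deg V m p q (V - A) = cut_deg V m p q V + 2 * (\<Sum>u\<in>A. \<Sum>v\<in>V - A. m u v)"
    using sum.subset_diff[OF assms finite_V, of p] sum.subset_diff[OF assms finite_V, of q]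
    by (simp add: cut_deg_def VA)
  show "demand b p q V = demand b p q A + demand b p q (V - A)"
    using sum.subset_diff[OF assms finite_V, of p] sum.subset_diff[OF assms finite_V, of q]
      sum.subset_diff[OF assms finite_V, of b] by (simp add: demand_def)
qed

text \<open>A vertex whose demand vanishes is made exempt by lifting two of its edges.\<close>

lemma no_null_vertex:
  assumes x: "x \<in> V" and null: "2 * k dvd demand b p q {x}" and xz: "x = z \<or> z \<notin> V"
  shows False
proof -
  have nrm0: "mod_norm k (demand b p q {x}) = 0" using null mod_norm_eq_0_iff[OF k_pos] by simp
  \<comment> \<open>From here on x is the exempt vertex. By \<open>xz\<close> no other singleton of
    V was exempt before, so all of them satisfy the ordinary bound.\<close>
  have key: "2 * k - 2 + mod_norm k (demand b p q A) \<le> cut_deg V m p q A - (if 2 \<le> card A then 2 else 0)"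
    if A: "A \<noteq> {}" "A \<subset> V" "A \<noteq> {x}" for A
  proof (cases "2 \<le> card A")
    case True then show ?thesis using slack[OF A(2)] by simp
  next
    case False
    then obtain v where "A = {v}" "v \<in> V" using proper_singletonE A by metis
    then have "A \<noteq> {z}" using A(3) xz by auto
    then show ?thesis using cut_ge A False by simp
  qed
  have fin: "finite A" if "A \<subset> V" for A using that finite_V finite_subset by auto
  \<comment> \<open>A cut that separates x from both y and w is {x}, which is exempt, or has at
    least two vertices and therefore two edges to spare.\<close>
  have nb_unique: False
    if "y \<in> V" "w \<in> V" "x \<noteq> y" "x \<noteq> w" "y \<noteq> w" "1 \<le> m x y" "1 \<le> m x w" for y w
  proof (rule lift_step[OF x that(1-7), of x])
    fix A assume A: "A \<noteq> {}" "A \<subset> V" "A \<noteq> {x}"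
    show "2 * k - 2 + mod_norm k (demand b p q A) \<le> cut_deg V m p q A -
         (if (x \<in> A) \<noteq> (y \<in> A) \<and> (x \<in> A) \<noteq> (w \<in> A) then 2 else 0)"
    proof (cases "2 \<le> card A")
      case True then show ?thesis using key[OF A] by simp
    next
      case False
      then obtain v where "A = {v}" using proper_singletonE A by metis
      then show ?thesis using key[OF A] A that by auto
    qed
  qed (use null in auto)
  \<comment> \<open>A special edge entering x followed by the edge xy is a pair that can be lifted
    too: the special edge is handed on to y, and xy is directed away from x.\<close>
  have p0: "p x \<le> 0" if y: "y \<in> V" "x \<noteq> y" "1 \<le> m x y" for y
  proof (rule ccontr)
    assume "\<not> p x \<le> 0"
    show False
    proof (rule orient_step[OF x y(1,2,3), of "\<lambda>v. p v - point x v + point y v" q x])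
      show "0 \<le> p v - point x v + point y v" if "v \<in> V" for v
        using p_nonneg[OF that] \<open>\<not> p x \<le> 0\<close> by (auto simp: point_def)
      fix A assume A: "A \<noteq> {}" "A \<subset> V" "A \<noteq> {x}"
      have 1: "demand b (\<lambda>v. p v - point x v + point y v) q A =
          demand b p q A + (if x \<in> A then 1 else 0) - (if y \<in> A then 1 else 0)"
        "cut_deg V m (\<lambda>v. p v - point x v + point y v) q A =
          cut_deg V m p q A - (if x \<in> A then 1 else 0) + (if y \<in> A then 1 else 0)"
        using fin[OF A(2)] by (simp_all add: demand_def cut_deg_def sum.distrib sum_subtractf sum_point)
      have "x \<notin> A" if "\<not> 2 \<le> card A" using proper_singletonE[OF A(1,2) that] A(3) by blast
      then show "2 * k - 2 + mod_norm k (demand b (\<lambda>v. p v - point x v + point y v) q A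
            - (if x \<in> A then 1 else 0) + (if y \<in> A then 1 else 0))
         \<le> cut_deg V m (\<lambda>v. p v - point x v + point y v) q A - (if (x \<in> A) \<noteq> (y \<in> A) then 1 else 0)"
        unfolding 1 using key[OF A] by (cases "2 \<le> card A") auto
    next
      have "cut_deg V m (\<lambda>v. p v - point x v + point y v) q V = cut_deg V m p q V"
        "demand b (\<lambda>v. p v - point x v + point y v) q V = demand b p q V"
        using finite_V x y by (simp_all add: demand_def cut_deg_def sum.distrib sum_subtractf sum_point)
      then show "cut_deg V m (\<lambda>v. p v - point x v + point y v) q V
          \<le> 2 * k - 2 + mod_norm k (demand b (\<lambda>v. p v - point x v + point y v) q V)" using root_le by simp
      have e: "demand b (\<lambda>v. p v - point x v + point y v) q {x} - 1 = demand b p q {x}"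
        using y by (simp add: demand_def point_def)
      show "2 * k dvd demand b (\<lambda>v. p v - point x v + point y v) q {x} - (if x = x then 1 else 0) + (if y = x then 1 else 0)"
        using null y e by simp
    qed (use q_nonneg in auto)
  qed
  have q0: "q x \<le> 0" if y: "y \<in> V" "x \<noteq> y" "1 \<le> m x y" for y
  proof (rule ccontr)
    assume "\<not> q x \<le> 0"
    show False
    proof (rule orient_step[OF y(1) x y(2)[symmetric], of p "\<lambda>v. q v - point x v + point y v" x])
      show "1 \<le> m y x" using y m_commute by simp
      show "0 \<le> q v - point x v + point y v" if "v \<in> V" for v
        using q_nonneg[OF that] \<open>\<not> q x \<le> 0\<close> by (auto simp: point_def)
      fix A assume A: "A \<noteq> {}" "A \<subset> V" "A \<noteq> {x}"
      have 1: "demand b p (\<lambda>v. q v - point x v + point y v) A =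
          demand b p q A - (if x \<in> A then 1 else 0) + (if y \<in> A then 1 else 0)"
        "cut_deg V m p (\<lambda>v. q v - point x v + point y v) A =
          cut_deg V m p q A - (if x \<in> A then 1 else 0) + (if y \<in> A then 1 else 0)"
        using fin[OF A(2)] by (simp_all add: demand_def cut_deg_def sum.distrib sum_subtractf sum_point)
      have "x \<notin> A" if "\<not> 2 \<le> card A" using proper_singletonE[OF A(1,2) that] A(3) by blast
      then show "2 * k - 2 + mod_norm k (demand b p (\<lambda>v. q v - point x v + point y v) A
            - (if y \<in> A then 1 else 0) + (if x \<in> A then 1 else 0))
         \<le> cut_deg V m p (\<lambda>v. q v - point x v + point y v) A - (if (y \<in> A) \<noteq> (x \<in> A) then 1 else 0)"
        unfolding 1 using key[OF A] by (cases "2 \<le> card A") auto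
    next
      have "cut_deg V m p (\<lambda>v. q v - point x v + point y v) V = cut_deg V m p q V"
        "demand b p (\<lambda>v. q v - point x v + point y v) V = demand b p q V"
        using finite_V x y by (simp_all add: demand_def cut_deg_def sum.distrib sum_subtractf sum_point)
      then show "cut_deg V m p (\<lambda>v. q v - point x v + point y v) V
          \<le> 2 * k - 2 + mod_norm k (demand b p (\<lambda>v. q v - point x v + point y v) V)" using root_le by simp
      have e: "demand b p (\<lambda>v. q v - point x v + point y v) {x} + 1 = demand b p q {x}"
        using y by (simp add: demand_def point_def)
      show "2 * k dvd demand b p (\<lambda>v. q v - point x v + point y v) {x} - (if y = x then 1 else 0) + (if x = x then 1 else 0)"
        using null y e by simp
    qed (use p_nonneg in auto)
  qed
  have single_deg: "cut_deg V m p q {x} = (\<Sum>v\<in>V - {x}. m x v) + p x + q x" by (simp add: cut_deg_def)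
  obtain u where u: "u \<in> V" "u \<noteq> x" and nb: "\<And>v. v \<in> V - {x, u} \<Longrightarrow> m x v = 0" and pq: "p x = 0" "q x = 0"
  proof (cases "\<exists>y\<in>V. x \<noteq> y \<and> 1 \<le> m x y")
    case True
    then obtain y where y: "y \<in> V" "x \<noteq> y" "1 \<le> m x y" by blast
    have "m x v = 0" if "v \<in> V - {x, y}" for v
      using nb_unique[OF y(1) _ y(2) _ _ y(3), of v] that m_nonneg[of x v] by fastforce
    then show ?thesis using that[of y] y p0[OF y] q0[OF y] p_nonneg[OF x] q_nonneg[OF x] by auto
  next
    case False
    then have m0: "m x v = 0" if "v \<in> V - {x}" for v using that m_nonneg[of x v] by fastforce
    then have cut0: "(\<Sum>v\<in>V - {x}. m x v) = 0" by simp
    obtain u where u: "u \<in> V" "u \<noteq> x" using single_proper[OF x] by blast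
    \<comment> \<open>An isolated x can have no special edges either: the cut bound for V - {x}
      already uses up everything that \<open>root_le\<close> allows.\<close>
    have "V - {x} \<noteq> {z}" using xz by auto
    then have 1: "2 * k - 2 + mod_norm k (demand b p q (V - {x})) \<le> cut_deg V m p q (V - {x})"
      using u x by (intro cut_ge) auto
    have "mod_norm k (demand b p q V) \<le> mod_norm k (demand b p q (V - {x}))"
      using deg_complement(2)[of "{x}"] x mod_norm_triangle[OF k_pos, of "demand b p q {x}" "demand b p q (V - {x})"] nrm0
      by simp
    then have "p x + q x \<le> 0"
      using 1 root_le deg_complement(1)[of "{x}"] x cut0 single_deg by simp
    then show ?thesis using that[of u] u m0 p_nonneg[OF x] q_nonneg[OF x] by auto
  qed
  show False
  proof (cases "x = z")
    case True
    then show False using exempt_not_pendant[of u] x u nb pq by simp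
  next
    case False
    \<comment> \<open>Now all edges at x, at least 2k - 2 of them, lead to the single vertex u, more
      than \<open>mult_small\<close> permits.\<close>
    then have "{x} \<noteq> {z}" by simp
    then have "2 * k - 2 \<le> cut_deg V m p q {x}"
      using cut_ge[of "{x}"] single_proper[OF x] nrm0 by simp
    moreover have "(\<Sum>v\<in>V - {x}. m x v) = m x u + (\<Sum>v\<in>V - {x} - {u}. m x v)"
      using u finite_V by (intro sum.remove) auto
    moreover have "(\<Sum>v\<in>V - {x} - {u}. m x v) = 0" using nb by (intro sum.neutral) auto
    ultimately have "2 * k - 2 \<le> m x u" using single_deg pq by simp
    then show False using mult_small[OF x u(1)] u(2) k2 by simp
  qed
qed

lemma z_notin: "z \<notin> V"
  using no_null_vertex[of z] exempt by blast

lemma mod_norm_nonzero: "v \<in> V \<Longrightarrow> mod_norm k (demand b p q {v}) \<noteq> 0"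
  using no_null_vertex[of v] z_notin mod_norm_eq_0_iff[OF k_pos] by blast

lemma pos_or_neg_vertex: "v \<in> V \<Longrightarrow> mod_pos k (demand b p q {v}) \<or> mod_pos k (- demand b p q {v})"
  using pos_or_neg[OF k_pos] mod_norm_nonzero by blast

lemma cut_ge_slack:
  assumes A: "A \<noteq> {}" "A \<subset> V"
  shows "2 * k - 2 + mod_norm k (demand b p q A) \<le> cut_deg V m p q A - (if 2 \<le> card A then 2 else 0)"
  using slack[OF A(2)] cut_ge[OF A] z_notin A by auto

text \<open>Directing xy from x to y lowers degree and distance by one at both ends. For a larger
  set the degree drops by at most one and the distance grows by at most one, which the two spare
  edges absorb.\<close>

lemma pos_neg_step:
  assumes xy: "x \<in> V" "y \<in> V" "x \<noteq> y" "1 \<le> m x y"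
    and pn: "mod_pos k (demand b p q {x})" "mod_pos k (- demand b p q {y})"
  shows False
proof (rule orient_step[OF xy, of p q z])
  fix A assume A: "A \<noteq> {}" "A \<subset> V"
  let ?t = "demand b p q A - (if x \<in> A then 1 else 0) + (if y \<in> A then 1 else 0)"
  show "2 * k - 2 + mod_norm k ?t \<le> cut_deg V m p q A - (if (x \<in> A) \<noteq> (y \<in> A) then 1 else 0)"
  proof (cases "2 \<le> card A")
    case True
    then show ?thesis using cut_ge_slack[OF A] mod_norm_lipschitz[OF k_pos, of ?t "demand b p q A"] by auto
  next
    case False
    then obtain v where v: "A = {v}" using proper_singletonE A by metis
    have "mod_norm k (demand b p q {y} + 1) = mod_norm k (demand b p q {y}) - 1"
      using pn(2) mod_norm_minus[of k "demand b p q {y} + 1"] unfolding mod_pos_def by simp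
    then show ?thesis using cut_ge_slack[OF A] pn(1) xy v unfolding mod_pos_def by auto
  qed
qed (use p_nonneg q_nonneg root_le z_notin in auto)

text \<open>Adding the bounds for A and V - A and subtracting \<open>root_le\<close> shows that
  twice the number of crossing edges is at least 2k - 2.\<close>

lemma edge_across:
  assumes A: "A \<noteq> {}" "A \<subset> V" obtains x y where "x \<in> A" "y \<in> V - A" "1 \<le> m x y"
proof -
  have A': "V - A \<noteq> {}" "V - A \<subset> V" using A by auto
  have "2 * k - 2 + mod_norm k (demand b p q A) \<le> cut_deg V m p q A"
    "2 * k - 2 + mod_norm k (demand b p q (V - A)) \<le> cut_deg V m p q (V - A)"
    using cut_ge[OF A] cut_ge[OF A'] z_notin A by auto
  then have "0 < (\<Sum>u\<in>A. \<Sum>v\<in>V - A. m u v)"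
    using deg_complement[OF psubset_imp_subset[OF A(2)]] root_le k2
      mod_norm_triangle[OF k_pos, of "demand b p q A" "demand b p q (V - A)"] by simp
  then obtain x where x: "x \<in> A" "0 < (\<Sum>v\<in>V - A. m x v)"
    by (meson not_le sum_nonpos)
  then obtain y where "y \<in> V - A" "0 < m x y" by (meson not_le sum_nonpos)
  then show ?thesis using that[of x y] x by auto
qed

text \<open>If all demands are positive, all edges at the special vertex leave it, and replacing an edge xy by an
  edge from the special vertex to y shows that there are exactly 2k - 1 of them. Then adding edges from x to the special vertex raises the demand of x
  to k, which is also -k modulo 2k, so an edge xy can be oriented towards x and deleted.\<close>

lemma not_all_pos:
  assumes all: "\<And>v. v \<in> V \<Longrightarrow> mod_pos k (demand b p q {v})" shows False
proof -
  have q0: "q v = 0" if v: "v \<in> V" for v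
  proof (rule ccontr)
    assume "q v \<noteq> 0"
    then have qv: "q v \<ge> 1" using q_nonneg[OF v] by simp
    let ?q = "\<lambda>w. q w - point v w"
    have 1: "demand b p ?q A = demand b p q A - (if v \<in> A then 1 else 0)"
      "cut_deg V m p ?q A = cut_deg V m p q A - (if v \<in> A then 1 else 0)" if "A \<subseteq> V" for A
      using finite_subset[OF that finite_V] by (simp_all add: demand_def cut_deg_def sum_subtractf sum_point)
    \<comment> \<open>Deleting a special edge that leaves v lowers both the degree and the distance
      of the positive vertex v by one. Here \<open>esize\<close> stays the same, and the number of
      special edges decreases.\<close>
    have cert: "certificate k V m b p ?q z"
    proof
      show "0 \<le> ?q w" if "w \<in> V" for w using q_nonneg[OF that] qv by (simp add: point_def)
      show "2 * k - 2 + mod_norm k (demand b p ?q A) \<le> cut_deg V m p ?q A"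
        if A: "A \<noteq> {}" "A \<subset> V" for A
      proof (cases "2 \<le> card A")
        case True
        then show ?thesis using cut_ge_slack[OF A] 1[of A] A
            mod_norm_lipschitz[OF k_pos, of "demand b p q A - 1" "demand b p q A"] by auto
      next
        case False
        then obtain w where "A = {w}" using proper_singletonE A by metis
        then show ?thesis using cut_ge_slack[OF A] 1[of A] A all unfolding mod_pos_def
          by (cases "v = w") auto
      qed
      show "cut_deg V m p ?q V \<le> 2 * k - 2 + mod_norm k (demand b p ?q V)"
        using root_le 1[of V] v mod_norm_lipschitz[OF k_pos, of "demand b p q V" "demand b p q V - 1"] by simp
    qed (use finite_V m_commute m_nonneg m_irrefl p_nonneg parity balanced z_notin in auto)
    have "sum ?q V = sum q V - 1" using finite_V v by (simp add: sum_subtractf sum_point)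
    then have "solvable k V m b" by (intro IH[OF cert]) simp
    then show False using unsolvable by simp
  qed
  define D where "D = sum p V"
  have q_sum: "sum q V = 0" using q0 by simp
  have degV: "cut_deg V m p q V = D" by (simp add: cut_deg_def D_def q_sum)
  have demV: "2 * k dvd demand b p q V + D" using balanced by (simp add: demand_def D_def q_sum)
  have nrmV: "mod_norm k (demand b p q V + c) = mod_norm k (c - D)" for c
    using demV by (intro mod_norm_cong) (simp add: algebra_simps)
  \<comment> \<open>The distance of D is at most |D - 2k|, so D >= 2k would contradict the bound at
    the root.\<close>
  have D_le: "D \<le> 2 * k - 1"
    using root_le degV nrmV[of 0] mod_norm_minus[of k D] mod_norm_le[OF k_pos, of D 1] by simp
  obtain a where "a \<in> V" using card_ge by fastforce
  then have "{a} \<subset> V" by (rule single_proper)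
  then obtain x y where "x \<in> {a}" "y \<in> V - {a}" "1 \<le> m x y"
    using edge_across[of "{a}"] by blast
  then have xy: "x \<in> V" "y \<in> V" "x \<noteq> y" "1 \<le> m x y" using \<open>a \<in> V\<close> by auto
  show False
  proof (cases "D \<le> 2 * k - 2")
    case True
    \<comment> \<open>At y an incoming edge from x is exchanged for an incoming special edge, so
      degree and demand of y stay as they are, while x loses one edge and one unit of
      demand.\<close>
    let ?p = "\<lambda>w. p w + point y w"
    have 1: "demand b ?p q A = demand b p q A - (if y \<in> A then 1 else 0)"
      "cut_deg V m ?p q A = cut_deg V m p q A + (if y \<in> A then 1 else 0)" if "A \<subseteq> V" for A
      using finite_subset[OF that finite_V] by (simp_all add: demand_def cut_deg_def sum.distrib sum_point)
    show False
    proof (rule orient_step[OF xy, of ?p q z])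
      show "0 \<le> ?p w" if "w \<in> V" for w using p_nonneg[OF that] by (simp add: point_def)
      show "2 * k - 2 + mod_norm k (demand b ?p q A - (if x \<in> A then 1 else 0) + (if y \<in> A then 1 else 0))
         \<le> cut_deg V m ?p q A - (if (x \<in> A) \<noteq> (y \<in> A) then 1 else 0)"
        if A: "A \<noteq> {}" "A \<subset> V" for A
      proof (cases "2 \<le> card A")
        case True
        then show ?thesis using cut_ge_slack[OF A] 1[of A] A
            mod_norm_lipschitz[OF k_pos, of "demand b p q A - 1" "demand b p q A"] by auto
      next
        case False
        then obtain w where "A = {w}" using proper_singletonE A by metis
        then show ?thesis using cut_ge_slack[OF A] 1[of A] A all xy unfolding mod_pos_def by auto
      qed
      have "mod_norm k (demand b p q V - 1) = mod_norm k (D + 1)"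
        using nrmV[of "-1"] mod_norm_minus[of k "- 1 - D"] by (simp add: add.commute)
      moreover have "D + 1 \<le> 2 * k - 2 + mod_norm k (D + 1)"
      proof (cases "D + 1 \<le> 2 * k - 2")
        case True then show ?thesis using mod_norm_nonneg[OF k_pos, of "D + 1"] by simp
      next
        case False
        then have D1: "D + 1 = 2 * k - 1" using \<open>D \<le> 2 * k - 2\<close> by simp
        moreover have "mod_norm k (2 * k - 1) = mod_norm k (- 1)" by (rule mod_norm_cong) simp
        moreover have "mod_norm k (- 1) = 1" using mod_norm_small[OF k_pos, of 1] k2 by simp
        ultimately show ?thesis unfolding D1 by simp
      qed
      ultimately show "cut_deg V m ?p q V \<le> 2 * k - 2 + mod_norm k (demand b ?p q V)"
        using 1[of V] xy degV by simp
    qed (use q_nonneg z_notin in auto)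
  next
    case False
    then have D: "D = 2 * k - 1" using D_le by simp
    \<comment> \<open>With i further special edges the demand of x has residue k, and the arc from y
      carries it to k + 1 at distance k - 1. The degree of x changes by i - 1 in total, which is
      just enough.\<close>
    define i where "i = k - mod_norm k (demand b p q {x})"
    have i: "0 \<le> i" "i + 1 \<le> k"
      using mod_norm_le_modulus[OF k_pos] pos_repr(2)[OF k_pos all[OF xy(1)]] by (auto simp: i_def)
    let ?q = "\<lambda>w. q w + i * point x w"
    have 1: "demand b p ?q A = demand b p q A + (if x \<in> A then i else 0)"
      "cut_deg V m p ?q A = cut_deg V m p q A + (if x \<in> A then i else 0)" if "A \<subseteq> V" for A
      using finite_subset[OF that finite_V]
      by (simp_all add: demand_def cut_deg_def sum.distrib sum_distrib_left[symmetric] sum_point)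
    show False
    proof (rule orient_step[OF xy(2,1) xy(3)[symmetric], of p ?q z])
      show "1 \<le> m y x" using xy m_commute by simp
      show "0 \<le> ?q w" if "w \<in> V" for w using q_nonneg[OF that] i by (simp add: point_def)
      show "2 * k - 2 + mod_norm k (demand b p ?q A - (if y \<in> A then 1 else 0) + (if x \<in> A then 1 else 0))
         \<le> cut_deg V m p ?q A - (if (y \<in> A) \<noteq> (x \<in> A) then 1 else 0)"
        if A: "A \<noteq> {}" "A \<subset> V" for A
      proof (cases "2 \<le> card A")
        case True
        then show ?thesis using cut_ge_slack[OF A] 1[of A] A i
            mod_norm_lipschitz[OF k_pos, of "demand b p q A - 1" "demand b p q A"]
            mod_norm_lipschitz[OF k_pos, of "demand b p q A + i" "demand b p q A"]
            mod_norm_lipschitz[OF k_pos, of "demand b p q A + i + 1" "demand b p q A"] by auto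
      next
        case False
        then obtain w where "A = {w}" using proper_singletonE A by metis
        moreover have "mod_norm k (demand b p q {x} + i + 1) \<le> k - 1"
          unfolding i_def using pos_wrap[OF k_pos all[OF xy(1)]] .
        ultimately show ?thesis
          using cut_ge_slack[OF A] 1[of A] A all[OF xy(2)] xy i_def unfolding mod_pos_def by auto
      qed
      \<comment> \<open>As D = 2k - 1, the demand of V is congruent to 1. Its distance grows to 1 +
        i along with the i new special edges, so the root bound holds with equality.\<close>
      have "mod_norm k (demand b p q V + i) = mod_norm k (1 + i)"
        unfolding nrmV D by (rule mod_norm_cong) (simp add: algebra_simps)
      also have "\<dots> = 1 + i" using i by (intro mod_norm_small[OF k_pos]) auto
      finally show "cut_deg V m p ?q V \<le> 2 * k - 2 + mod_norm k (demand b p ?q V)"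
        using 1[of V] xy degV D by simp
    qed (use p_nonneg z_notin in auto)
  qed
qed

text \<open>Reversing all edges, the special ones included, exchanges p with q and positive with
  negative vertices.\<close>

lemma negated: "stuck k V m (\<lambda>v. - b v) q p z"
proof -
  have d: "demand (\<lambda>v. - b v) q p A = - demand b p q A" "cut_deg V m q p A = cut_deg V m p q A" for A
    by (simp_all add: demand_def cut_deg_def sum_negf)
  show ?thesis
  proof unfold_locales
    show "solvable k V' m' b'" if "certificate k V' m' b' p' q' z'"
      "esize V' m' < esize V m \<or> esize V' m' = esize V m \<and> sum p' V' + sum q' V' < sum q V + sum p V"
      for V' :: "'a set" and m' b' p' q' z'
      using IH[OF that(1)] that(2) by (simp add: add.commute)
    show "even ((\<Sum>u\<in>V. m v u) + - b v)" if "v \<in> V" for v using parity[OF that] by simp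
    show "2 * k dvd (\<Sum>v\<in>V. - b v)" using balanced by (simp add: sum_negf)
    show "\<not> solvable k V m (\<lambda>v. - b v)" using unsolvable solvable_negate by blast
  qed (use finite_V m_commute m_nonneg m_irrefl p_nonneg q_nonneg k2 cut_ge root_le exempt d in auto)
qed

lemma contradiction: False
proof -
  define P where "P = {v \<in> V. mod_pos k (demand b p q {v})}"
  consider "P = V" | "P = {}" | "P \<noteq> {}" "P \<subset> V" unfolding P_def by blast
  then show False
  proof cases
    case 1
    then show False using not_all_pos unfolding P_def by blast
  next
    case 2
    have "demand (\<lambda>v. - b v) q p {v} = - demand b p q {v}" for v by (simp add: demand_def)
    then show False using stuck.not_all_pos[OF negated] 2 pos_or_neg_vertex unfolding P_def by auto
  next
    case 3
    then obtain x y where xy: "x \<in> P" "y \<in> V - P" "1 \<le> m x y" using edge_across by metis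
    then show False using pos_neg_step[of x y] pos_or_neg_vertex unfolding P_def by auto
  qed
qed

end

theorem certificate_solvable:
  fixes V :: "'a set"
  assumes "certificate k V m b p q z" "2 \<le> k"
  shows "solvable k V m b"
  using assms(1)
proof (induction "(esize V m, nat (sum p V + sum q V))" arbitrary: V m b p q z
    rule: wf_induct_rule[OF wf_lex_prod[OF wf_less_than wf_less_than]])
  case 1
  interpret certificate k V m b p q z by fact
  show ?case
  proof (rule ccontr)
    assume uns: "\<not> solvable k V m b"
    have "stuck k V m b p q z"
    proof unfold_locales
      fix V' :: "'a set" and m' b' p' q' z'
      assume c: "certificate k V' m' b' p' q' z'"
       and "esize V' m' < esize V m \<or> esize V' m' = esize V m \<and> sum p' V' + sum q' V' < sum p V + sum q V"
      moreover have "0 \<le> sum p' V' + sum q' V'"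
        using certificate.p_nonneg[OF c] certificate.q_nonneg[OF c] by (simp add: sum_nonneg)
      ultimately have "((esize V' m', nat (sum p' V' + sum q' V')), (esize V m, nat (sum p V + sum q V)))
          \<in> less_than <*lex*> less_than" by auto
      then show "solvable k V' m' b'" using "1.hyps" c by blast
    qed (use assms uns in auto)
    then show False by (rule stuck.contradiction)
  qed
qed

section \<open>Star decompositions of graphs without dense sets of small boundary\<close>

text \<open>Ordered pairs: an edge inside A contributes two elements to \<open>arcs E A A\<close>,
  an edge between disjoint sets A and B contributes one to \<open>arcs E A B\<close>.\<close>

definition arcs :: "nat set set \<Rightarrow> nat set \<Rightarrow> nat set \<Rightarrow> (nat \<times> nat) set" where
  "arcs E A B = {(u, v). u \<in> A \<and> v \<in> B \<and> {u, v} \<in> E}"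

lemma finite_arcs [simp]: "finite A \<Longrightarrow> finite B \<Longrightarrow> finite (arcs E A B)"
  by (rule finite_subset[of _ "A \<times> B"]) (auto simp: arcs_def)

lemma regular_graphs_irrefl: "E \<in> regular_graphs n d \<Longrightarrow> {v, v} \<notin> E"
  by (auto simp: regular_graphs_def all_edges_def)

lemma card_neighbours_eq:
  assumes "E \<subseteq> all_edges n"
  shows "card {u \<in> {1..n}. {v, u} \<in> E} = card {e \<in> E. v \<in> e}"
proof -
  have "bij_betw (\<lambda>u. {v, u}) {u \<in> {1..n}. {v, u} \<in> E} {e \<in> E. v \<in> e}"
  proof (rule bij_betwI')
    fix e assume e: "e \<in> {e \<in> E. v \<in> e}"
    then have "card e = 2" "e \<subseteq> {1..n}" using assms by (auto simp: all_edges_def)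
    then obtain x y where "e = {x, y}" by (auto simp: card_2_iff)
    then show "\<exists>u\<in>{u \<in> {1..n}. {v, u} \<in> E}. e = {v, u}"
      using e \<open>e \<subseteq> {1..n}\<close> by (auto simp: insert_commute)
  qed (auto simp: doubleton_eq_iff)
  then show ?thesis by (rule bij_betw_same_card)
qed

lemma card_neighbours:
  assumes "E \<in> regular_graphs n d" "v \<in> {1..n}"
  shows "card {u \<in> {1..n}. {v, u} \<in> E} = d"
  using assms card_neighbours_eq[of E n v] by (auto simp: regular_graphs_def)

lemma card_arcs_sum:
  assumes "finite A" "finite B"
  shows "card (arcs E A B) = (\<Sum>u\<in>A. card {v \<in> B. {u, v} \<in> E})"
proof -
  have "arcs E A B = Sigma A (\<lambda>u. {v \<in> B. {u, v} \<in> E})" by (auto simp: arcs_def)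
  then show ?thesis using assms by (simp add: card_SigmaI)
qed

lemma card_arcs_regular:
  assumes "E \<in> regular_graphs n d" "A \<subseteq> {1..n}"
  shows "card (arcs E A {1..n}) = d * card A"
proof -
  have "card (arcs E A {1..n}) = (\<Sum>u\<in>A. d)"
    unfolding card_arcs_sum[OF finite_subset[OF assms(2) finite_atLeastAtMost] finite_atLeastAtMost]
    by (intro sum.cong refl card_neighbours[OF assms(1)]) (use assms(2) in blast)
  then show ?thesis by simp
qed

lemma card_arcs_split:
  assumes "E \<in> regular_graphs n d" "A \<subseteq> {1..n}"
  shows "card (arcs E A A) + card (arcs E A ({1..n} - A)) = d * card A"
proof -
  have fA: "finite A" using assms finite_subset by blast
  have "arcs E A {1..n} = arcs E A A \<union> arcs E A ({1..n} - A)"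
    "arcs E A A \<inter> arcs E A ({1..n} - A) = {}"
    using assms(2) by (auto simp: arcs_def)
  then have "card (arcs E A {1..n}) = card (arcs E A A) + card (arcs E A ({1..n} - A))"
    using fA by (simp add: card_Un_disjoint)
  then show ?thesis using card_arcs_regular[OF assms] by simp
qed

lemma card_arcs_commute: "card (arcs E A B) = card (arcs E B A)"
proof -
  have "arcs E B A = prod.swap ` arcs E A B" by (auto simp: arcs_def insert_commute)
  then show ?thesis by (simp add: card_image)
qed

section \<open>From orientations and cut bounds to stars\<close>

lemma partition_into_card:
  assumes "finite S" "k > 0" "k dvd card S"
  shows "\<exists>P. \<Union>P = S \<and> (\<forall>T\<in>P. card T = k) \<and> (\<forall>T\<in>P. \<forall>U\<in>P. T \<noteq> U \<longrightarrow> T \<inter> U = {})"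
proof -
  obtain c where "card S = c * k" using assms(3) by (metis dvd_def mult.commute)
  then show ?thesis using assms(1)
  proof (induction c arbitrary: S)
    case 0
    then have "S = {}" by simp
    then show ?case by (intro exI[of _ "{}"]) simp
  next
    case (Suc c)
    obtain T where T: "T \<subseteq> S" "card T = k" "finite T"
      using obtain_subset_with_card_n[of k S] Suc.prems by auto
    have "card (S - T) = c * k" using Suc.prems T by (simp add: card_Diff_subset)
    then obtain P where P: "\<Union>P = S - T" "\<forall>T\<in>P. card T = k" "\<forall>T\<in>P. \<forall>U\<in>P. T \<noteq> U \<longrightarrow> T \<inter> U = {}"
      using Suc.IH[of "S - T"] Suc.prems by auto
    have "U \<inter> T = {}" if "U \<in> P" for U using P(1) that by blast
    then show ?case using P T by (intro exI[of _ "insert T P"]) auto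
  qed
qed

text \<open>The net out-flow of v plus d is twice its out-degree, so k divides every out-degree. The
  edges leaving v can therefore be grouped into stars centred at v, and each edge leaves exactly one
  vertex.\<close>

lemma star_decomposition_of_orientation:
  fixes k :: nat
  assumes E: "E \<in> regular_graphs n d" and k: "0 < k"
    and f: "orients {1..n} (\<lambda>u v. if {u, v} \<in> E then 1 else 0) f"
    and net: "\<And>v. v \<in> {1..n} \<Longrightarrow> 2 * int k dvd net {1..n} f v + int d"
  shows "has_star_decomposition k E"
proof -
  let ?V = "{1..n}"
  define O' where "O' v = {u \<in> ?V. f v u = 1}" for v
  define S where "S v = (\<lambda>u. {v, u}) ` O' v" for v
  have f01: "f u v = 0 \<or> f u v = 1" "f u v + f v u = (if {u, v} \<in> E then 1 else 0)" "f u v \<ge> 0"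
    if "u \<in> ?V" "v \<in> ?V" for u v
  proof -
    have "0 \<le> f u v" "0 \<le> f v u" "f u v + f v u = (if {u, v} \<in> E then 1 else 0)"
      using f that unfolding orients_def by auto
    then show "f u v = 0 \<or> f u v = 1" "f u v + f v u = (if {u, v} \<in> E then 1 else 0)" "f u v \<ge> 0"
      by (auto split: if_splits)
  qed
  have S_card: "k dvd card (S v)" if v: "v \<in> ?V" for v
  proof -
    have inj: "inj_on (\<lambda>u. {v, u}) (O' v)" by (auto simp: inj_on_def doubleton_eq_iff)
    have "net ?V f v = (\<Sum>u\<in>?V. 2 * f v u - (if {v, u} \<in> E then 1 else 0))"
      unfolding net_def using f01(2)[OF v] by (intro sum.cong refl) (simp add: algebra_simps)
    also have "\<dots> = 2 * (\<Sum>u\<in>?V. f v u) - (\<Sum>u\<in>?V. if {v, u} \<in> E then 1 else 0)"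
      by (simp only: sum_subtractf sum_distrib_left)
    also have "(\<Sum>u\<in>?V. if {v, u} \<in> E then 1 else 0) = int (card {u \<in> ?V. {v, u} \<in> E})"
      by (simp add: sum.If_cases Int_def)
    also have "(\<Sum>u\<in>?V. f v u) = (\<Sum>u\<in>?V. if f v u = 1 then 1 else 0)"
      using f01(1)[OF v] by (intro sum.cong refl) auto
    also have "\<dots> = int (card (O' v))" by (simp add: sum.If_cases Int_def O'_def)
    finally have "net ?V f v + int d = 2 * int (card (O' v))" using card_neighbours[OF E v] by simp
    then have "2 * int k dvd 2 * int (card (O' v))" using net[OF v] by simp
    then show ?thesis unfolding S_def by (simp add: card_image[OF inj])
  qed
  have "\<exists>P. \<Union>P = S v \<and> (\<forall>T\<in>P. card T = k) \<and> (\<forall>T\<in>P. \<forall>U\<in>P. T \<noteq> U \<longrightarrow> T \<inter> U = {})"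
    if v: "v \<in> ?V" for v
    using partition_into_card[OF _ k S_card[OF v]] by (simp add: S_def O'_def)
  then obtain P where P: "\<And>v. v \<in> ?V \<Longrightarrow> \<Union>(P v) = S v"
    "\<And>v T. v \<in> ?V \<Longrightarrow> T \<in> P v \<Longrightarrow> card T = k"
    "\<And>v T U. v \<in> ?V \<Longrightarrow> T \<in> P v \<Longrightarrow> U \<in> P v \<Longrightarrow> T \<noteq> U \<Longrightarrow> T \<inter> U = {}"
    by metis
  have SE: "S v \<subseteq> E" if "v \<in> ?V" for v
  proof
    fix e assume "e \<in> S v"
    then obtain u where u: "u \<in> ?V" "f v u = 1" "e = {v, u}" unfolding S_def O'_def by auto
    then show "e \<in> E" using f01(2)[OF that u(1)] f01(3)[OF u(1) that] by (auto split: if_splits)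
  qed
  have ES: "e \<in> (\<Union>v\<in>?V. S v)" if e: "e \<in> E" for e
  proof -
    have "card e = 2" "e \<subseteq> ?V" using e E by (auto simp: regular_graphs_def all_edges_def)
    then obtain x y where xy: "e = {x, y}" "x \<in> ?V" "y \<in> ?V" by (auto simp: card_2_iff)
    then have "f x y = 1 \<or> f y x = 1" using f01[of x y] f01[of y x] e by auto
    then show ?thesis using xy unfolding S_def O'_def by (auto simp: insert_commute)
  qed
  have disj: "S v \<inter> S w = {}" if vw: "v \<in> ?V" "w \<in> ?V" "v \<noteq> w" for v w
  proof (rule ccontr)
    assume "S v \<inter> S w \<noteq> {}"
    then have "f v w = 1" "f w v = 1" using vw unfolding S_def O'_def by (auto simp: doubleton_eq_iff)
    then show False using f01(2)[OF vw(1,2)] by (auto split: if_splits)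
  qed
  show ?thesis
    unfolding has_star_decomposition_def
  proof (intro exI[of _ "\<Union>v\<in>?V. P v"] conjI ballI impI)
    have "\<Union>(\<Union>v\<in>?V. P v) = (\<Union>v\<in>?V. \<Union>(P v))" by blast
    also have "\<dots> = (\<Union>v\<in>?V. S v)" by (intro SUP_cong refl P(1))
    also have "\<dots> = E" by (intro equalityI UN_least SE subsetI ES)
    finally show "\<Union>(\<Union>v\<in>?V. P v) = E" .
    fix T assume "T \<in> (\<Union>v\<in>?V. P v)"
    then obtain v where v: "v \<in> ?V" "T \<in> P v" by blast
    have "\<forall>e\<in>T. v \<in> e" using P(1)[OF v(1)] v(2) unfolding S_def by blast
    then show "is_k_star k T" unfolding is_k_star_def using P(2)[OF v] by blast
    fix U assume "U \<in> (\<Union>v\<in>?V. P v)" and "T \<noteq> U"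
    then obtain w where w: "w \<in> ?V" "U \<in> P w" by blast
    show "T \<inter> U = {}"
    proof (cases "v = w")
      case True then show ?thesis using P(3) v w \<open>T \<noteq> U\<close> by blast
    next
      case False
      have "T \<subseteq> S v" "U \<subseteq> S w" using P(1) v w by auto
      then show ?thesis using disj[OF v(1) w(1) False] by blast
    qed
  qed
qed

lemma star_decomposition_of_cuts:
  fixes k :: nat
  assumes E: "E \<in> regular_graphs n d" and k: "2 \<le> k" and d: "2 * k \<le> d + 1"
    and dvd: "2 * k dvd d * n"
    and cuts: "\<And>A. A \<subseteq> {1..n} \<Longrightarrow> 2 \<le> card A \<Longrightarrow> card A + 2 \<le> n \<Longrightarrow>
       2 * int k - 2 + mod_norm (int k) (int d * int (card A)) \<le> int (card (arcs E A ({1..n} - A)))"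
  shows "has_star_decomposition k E"
proof -
  let ?V = "{1..n}" and ?k = "int k"
  let ?m = "\<lambda>u v. if {u, v} \<in> E then 1 else (0::int)"
  have kp: "?k > 0" using k by simp
  have deg1: "cut_deg ?V ?m (\<lambda>_. 0) (\<lambda>_. 0) A = int (card (arcs E A (?V - A)))" if "A \<subseteq> ?V" for A
  proof -
    have "(\<Sum>v\<in>?V - A. ?m u v) = int (card {v \<in> ?V - A. {u, v} \<in> E})" for u
      by (simp add: sum.If_cases Int_def)
    then show ?thesis using finite_subset[OF that] by (simp add: cut_deg_def card_arcs_sum)
  qed
  have dem1: "demand (\<lambda>_. - int d) (\<lambda>_. 0) (\<lambda>_. 0) A = - (int d * int (card A))" for A :: "nat set"
    by (simp add: demand_def)
  have dn: "2 * ?k dvd int d * int n"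
    using dvd by (metis int_dvd_int_iff of_nat_mult of_nat_numeral)
  \<comment> \<open>For d >= 2k the distance is at most d - 2k. The remaining case d = 2k - 1 has
    distance at most 1, which meets the bound exactly.\<close>
  have nrm_d: "mod_norm ?k (int d) \<le> int d - 2 * ?k + 2"
    using mod_norm_le[OF kp, of "int d" 1] d by auto
  \<comment> \<open>There are no special edges, and the exempt vertex 0 lies outside the vertex set,
    so no cut is exempt.\<close>
  have "certificate ?k ?V ?m (\<lambda>_. - int d) (\<lambda>_. 0) (\<lambda>_. 0) 0"
  proof
    show "?m u v = ?m v u" for u v by (simp add: insert_commute)
    show "?m v v = 0" for v using regular_graphs_irrefl[OF E] by simp
    show "even ((\<Sum>u\<in>?V. ?m v u) + - int d)" if "v \<in> ?V" for v
      using card_neighbours[OF E that] by (simp add: sum.If_cases Int_def)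
    show "2 * ?k dvd (\<Sum>v\<in>?V. - int d)" using dn by (simp add: mult.commute)
    show "cut_deg ?V ?m (\<lambda>_. 0) (\<lambda>_. 0) ?V \<le> 2 * ?k - 2 + mod_norm ?k (demand (\<lambda>_. - int d) (\<lambda>_. 0) (\<lambda>_. 0) ?V)"
      using k mod_norm_nonneg[OF kp] deg1[of ?V] by (simp add: arcs_def)
    show "2 * ?k - 2 + mod_norm ?k (demand (\<lambda>_. - int d) (\<lambda>_. 0) (\<lambda>_. 0) A) \<le> cut_deg ?V ?m (\<lambda>_. 0) (\<lambda>_. 0) A"
      if A: "A \<noteq> {}" "A \<subset> ?V" for A
    proof -
      have fA: "finite A" using A(2) finite_subset by blast
      have cA: "card A \<noteq> 0" "card A < n" using A fA psubset_card_mono[OF _ A(2)] by auto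
      have goal: "2 * ?k - 2 + mod_norm ?k (int d * int (card A)) \<le> int (card (arcs E A (?V - A)))"
      proof -
        consider "card A = 1" | "card A + 1 = n" | "2 \<le> card A" "card A + 2 \<le> n" using cA by linarith
        then show ?thesis
        proof cases
          case 1
          then obtain v where v: "A = {v}" by (auto simp: card_1_singleton_iff)
          have "arcs E A A = {}" using v regular_graphs_irrefl[OF E] by (auto simp: arcs_def)
          then have "card (arcs E A (?V - A)) = d" using card_arcs_split[OF E, of A] A 1 by auto
          then show ?thesis using nrm_d 1 by simp
        next
          case 2
          \<comment> \<open>The complement of a vertex has the same boundary as the vertex, and
            modulo 2k its demand is the opposite one because 2k divides d n.\<close>
          have "card (?V - A) = 1" using 2 A fA by (simp add: card_Diff_subset)
          then obtain v where v: "?V - A = {v}" by (auto simp: card_1_singleton_iff)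
          have VA: "?V - {v} = A" and vV: "{v} \<subseteq> ?V" using A v by blast+
          have "arcs E {v} {v} = {}" using regular_graphs_irrefl[OF E] by (auto simp: arcs_def)
          then have "card (arcs E {v} (?V - {v})) = d" using card_arcs_split[OF E vV] by simp
          then have "card (arcs E A (?V - A)) = d" unfolding VA v using card_arcs_commute by metis
          moreover have "mod_norm ?k (int d * int (card A)) = mod_norm ?k (- int d)"
            using dn 2 by (intro mod_norm_cong) (metis diff_minus_eq_add distrib_left mult.right_neutral of_nat_1 of_nat_add)
          ultimately show ?thesis using nrm_d by simp
        next
          case 3 then show ?thesis using cuts A by blast
        qed
      qed
      then show ?thesis using deg1 A dem1 by simp
    qed
  qed auto
  then have "solvable ?k ?V ?m (\<lambda>_. - int d)" using k by (intro certificate_solvable) auto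
  then obtain f where "orients ?V ?m f" "\<And>v. v \<in> ?V \<Longrightarrow> 2 * ?k dvd net ?V f v - - int d"
    unfolding solvable_def by blast
  then show ?thesis using star_decomposition_of_orientation[OF E, of k f] k by simp
qed

text \<open>With c boundary edges, A spans (d |A| - c) / 2 edges; the second alternative bounds this
  number by |A|, stated without subtraction or division.\<close>

definition sparse_or_cut :: "nat \<Rightarrow> nat \<Rightarrow> nat \<Rightarrow> nat set set \<Rightarrow> bool" where
  "sparse_or_cut n d C E \<longleftrightarrow> (\<forall>A\<subseteq>{1..n}. 2 * card A \<le> n \<longrightarrow>
     C \<le> card (arcs E A ({1..n} - A)) \<or> d * card A \<le> card (arcs E A ({1..n} - A)) + 2 * card A)"

text \<open>A boundary of 3k - 2 edges suffices for every demand. Otherwise A has at least (d - 2)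
  |A| boundary edges, and only two vertices, or three vertices with k = 2 and d = 3, need a closer
  look.\<close>

lemma star_decomposition_of_sparse:
  fixes k :: nat
  assumes E: "E \<in> regular_graphs n d" and k: "2 \<le> k" and d: "2 * k \<le> d + 1"
    and dvd: "2 * k dvd d * n" and sp: "sparse_or_cut n d (3 * k - 2) E"
  shows "has_star_decomposition k E"
proof (rule star_decomposition_of_cuts[OF E k d dvd])
  let ?V = "{1..n}" and ?k = "int k"
  have kp: "?k > 0" using k by simp
  have small: "2 * ?k - 2 + mod_norm ?k (int d * int (card A)) \<le> int (card (arcs E A (?V - A)))"
    if A: "A \<subseteq> ?V" "2 \<le> card A" "2 * card A \<le> n" for A
  proof -
    define a where "a = card A"
    define c where "c = card (arcs E A (?V - A))"
    have nk: "mod_norm ?k (int d * int a) \<le> ?k" by (rule mod_norm_le_modulus[OF kp])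
    have "3 * k - 2 \<le> c \<or> d * a \<le> c + 2 * a"
      using sp A unfolding sparse_or_cut_def a_def c_def by blast
    then show ?thesis
    proof
      assume "3 * k - 2 \<le> c"
      then show ?thesis using nk k unfolding a_def c_def by linarith
    next
      assume *: "d * a \<le> c + 2 * a"
      have fA: "finite A" using A finite_subset by blast
      consider "a = 2" | "a = 3" "k = 2" "d = 3" | "4 \<le> a" "k = 2" "d = 3" | "3 \<le> a" "k = 2" "4 \<le> d"
        | "3 \<le> a" "3 \<le> k"
        using A(2) k d unfolding a_def by linarith
      then show ?thesis
      proof cases
        case 1
        \<comment> \<open>Two vertices span at most one edge, which improves the boundary to 2d -
          2.\<close>
        have "arcs E A A \<subseteq> A \<times> A - Id_on A" using regular_graphs_irrefl[OF E] by (auto simp: arcs_def)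
        moreover have "card (A \<times> A - Id_on A) = 2"
        proof -
          have "Id_on A \<subseteq> A \<times> A" "card (Id_on A) = a"
            using fA by (auto simp: Id_on_eqI a_def Id_on_def card_UN_disjoint)
          then show ?thesis using fA 1 unfolding a_def
            by (subst card_Diff_subset) (auto intro: finite_subset)
        qed
        ultimately have "card (arcs E A A) \<le> 2" using fA
          by (metis card_mono finite_Diff finite_cartesian_product)
        then have "2 * d \<le> c + 2" using card_arcs_split[OF E A(1)] 1 unfolding a_def c_def by simp
        then show ?thesis using nk k d unfolding a_def c_def by linarith
      next
        case 2
        \<comment> \<open>Three boundary edges fall short of 3k - 2 = 4, but the demand 9 is at
          distance one from 8, a multiple of 2k = 4.\<close>
        then have "mod_norm ?k (int d * int a) \<le> 1" using mod_norm_le[OF kp, of 9 2] by simp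
        then show ?thesis using * 2 unfolding a_def c_def by simp
      next
        case 3
        then have "4 \<le> c" using * by simp
        then show ?thesis using 3 nk unfolding a_def c_def by simp
      next
        case 4
        then have "4 * a \<le> d * a" by simp
        then have "6 \<le> c" using * 4(1) by linarith
        then show ?thesis using 4 nk unfolding a_def c_def by simp
      next
        case 5
        have "(2 * k - 3) * 3 \<le> (d - 2) * a" using 5 d by (intro mult_le_mono) auto
        moreover have "(d - 2) * a = d * a - 2 * a" by (simp add: diff_mult_distrib)
        ultimately have "(2 * k - 3) * 3 \<le> c" using * by linarith
        then have "6 * k \<le> c + 9" by (simp add: diff_mult_distrib)
        then show ?thesis using 5 nk unfolding a_def c_def by linarith
      qed
    qed
  qed
  fix A assume A: "A \<subseteq> ?V" "2 \<le> card A" "card A + 2 \<le> n"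
  show "2 * ?k - 2 + mod_norm ?k (int d * int (card A)) \<le> int (card (arcs E A (?V - A)))"
  proof (cases "2 * card A \<le> n")
    case True then show ?thesis using small A by blast
  next
    case False
    have cB: "card (?V - A) = n - card A" using A(1) finite_subset[OF A(1)] by (simp add: card_Diff_subset)
    have "?V - (?V - A) = A" using A by auto
    moreover have "2 * ?k - 2 + mod_norm ?k (int d * int (card (?V - A)))
        \<le> int (card (arcs E (?V - A) (?V - (?V - A))))"
      using A False cB by (intro small) auto
    moreover have "mod_norm ?k (int d * int (card (?V - A))) = mod_norm ?k (- (int d * int (card A)))"
    proof (rule mod_norm_cong)
      have "int d * int (card (?V - A)) - - (int d * int (card A)) = int d * int n"
        using cB A by (simp add: algebra_simps of_nat_diff flip: distrib_left)
      moreover have "2 * ?k dvd int d * int n"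
        using dvd by (metis int_dvd_int_iff of_nat_mult of_nat_numeral)
      ultimately show "2 * ?k dvd int d * int (card (?V - A)) - - (int d * int (card A))" by simp
    qed
    ultimately show ?thesis using card_arcs_commute[of E A "?V - A"] by simp
  qed
qed

section \<open>Switchings across a cut\<close>

definition switch :: "nat set set \<Rightarrow> nat \<Rightarrow> nat \<Rightarrow> nat \<Rightarrow> nat \<Rightarrow> nat set set" where
  "switch E u v x y = (E - {{u, v}, {x, y}}) \<union> {{u, x}, {v, y}}"

definition cut_graphs :: "nat \<Rightarrow> nat \<Rightarrow> nat set \<Rightarrow> nat \<Rightarrow> nat set set set" where
  "cut_graphs n d A c = {E \<in> regular_graphs n d. card (arcs E A ({1..n} - A)) = c}"

text \<open>Both edges are taken with a direction, which decides how they are reconnected.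
  Accordingly the reverse count below uses ordered pairs of cut edges.\<close>

definition switchings :: "nat set set \<Rightarrow> nat set \<Rightarrow> nat set \<Rightarrow> ((nat \<times> nat) \<times> (nat \<times> nat)) set" where
  "switchings E A B = {((u, v), (x, y)). (u, v) \<in> arcs E A A \<and> (x, y) \<in> arcs E B B \<and>
     {u, x} \<notin> E \<and> {v, y} \<notin> E}"

lemma finite_regular_graphs [simp]: "finite (regular_graphs n d)"
proof -
  have "finite (all_edges n)" unfolding all_edges_def by (rule finite_subset[of _ "Pow {1..n}"]) auto
  then show ?thesis by (rule_tac finite_subset[of _ "Pow (all_edges n)"]) (auto simp: regular_graphs_def)
qed

lemma card_switch_filter:
  assumes "finite E" "e1 \<in> E" "e2 \<in> E" "e1 \<noteq> e2" "e3 \<notin> E" "e4 \<notin> E" "e3 \<noteq> e4"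
  shows "card {e \<in> (E - {e1, e2}) \<union> {e3, e4}. P e} + (if P e1 then 1 else 0) + (if P e2 then 1 else 0)
    = card {e \<in> E. P e} + (if P e3 then 1 else 0) + (if P e4 then 1 else 0)"
proof -
  define R where "R = {e \<in> E - {e1, e2}. P e}"
  have fR: "finite R" using assms(1) by (simp add: R_def)
  have two: "card {e \<in> {a, b}. P e} = (if P a then 1 else 0) + (if P b then 1 else 0)" if "a \<noteq> b" for a b
  proof -
    have "{e \<in> {a, b}. P e} = (if P a then {a} else {}) \<union> (if P b then {b} else {})" by auto
    then show ?thesis using that by auto
  qed
  have "{e \<in> E. P e} = R \<union> {e \<in> {e1, e2}. P e}" "R \<inter> {e \<in> {e1, e2}. P e} = {}"
    using assms by (auto simp: R_def)
  then have 1: "card {e \<in> E. P e} = card R + card {e \<in> {e1, e2}. P e}"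
    using fR by (simp add: card_Un_disjoint)
  have "{e \<in> (E - {e1, e2}) \<union> {e3, e4}. P e} = R \<union> {e \<in> {e3, e4}. P e}" "R \<inter> {e \<in> {e3, e4}. P e} = {}"
    using assms by (auto simp: R_def)
  then have "card {e \<in> (E - {e1, e2}) \<union> {e3, e4}. P e} = card R + card {e \<in> {e3, e4}. P e}"
    using fR by (simp add: card_Un_disjoint)
  then show ?thesis using 1 two[OF assms(4)] two[OF assms(7)] by simp
qed

context
  fixes n d :: nat and A B :: "nat set" and E u v x y
  assumes A: "A \<subseteq> {1..n}" and B: "B = {1..n} - A" and E: "E \<in> regular_graphs n d"
    and sw: "((u, v), (x, y)) \<in> switchings E A B"
begin

lemma switch_facts:
  "u \<in> A" "v \<in> A" "x \<in> B" "y \<in> B" "{u, v} \<in> E" "{x, y} \<in> E" "{u, x} \<notin> E" "{v, y} \<notin> E"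
  "u \<noteq> v" "x \<noteq> y" "u \<noteq> x" "u \<noteq> y" "v \<noteq> x" "v \<noteq> y"
proof -
  have *: "u \<in> A \<and> v \<in> A \<and> x \<in> B \<and> y \<in> B \<and> {u, v} \<in> E \<and> {x, y} \<in> E \<and> {u, x} \<notin> E \<and> {v, y} \<notin> E"
    using sw by (simp add: switchings_def arcs_def)
  then show "u \<in> A" "v \<in> A" "x \<in> B" "y \<in> B" "{u, v} \<in> E" "{x, y} \<in> E" "{u, x} \<notin> E" "{v, y} \<notin> E"
    by simp_all
  show "u \<noteq> v" "x \<noteq> y" using * regular_graphs_irrefl[OF E] by metis+
  show "u \<noteq> x" "u \<noteq> y" "v \<noteq> x" "v \<noteq> y" using * B by auto
qed

lemma switch_regular: "switch E u v x y \<in> regular_graphs n d"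
proof -
  note f = switch_facts
  have fE: "finite E" using E finite_subset[of E "all_edges n"]
    by (auto simp: regular_graphs_def all_edges_def intro: finite_subset[of _ "Pow {1..n}"])
  have "switch E u v x y \<subseteq> all_edges n"
  proof -
    have "{u, x} \<in> all_edges n" "{v, y} \<in> all_edges n"
      using f(1-4,11,14) A B by (auto simp: all_edges_def)
    then show ?thesis using E unfolding switch_def regular_graphs_def by auto
  qed
  moreover have "card {e \<in> switch E u v x y. w \<in> e} = d" if "w \<in> {1..n}" for w
  proof -
    have "card {e \<in> switch E u v x y. w \<in> e}
       + (if w \<in> {u, v} then 1 else 0) + (if w \<in> {x, y} then 1 else 0)
       = card {e \<in> E. w \<in> e} + (if w \<in> {u, x} then 1 else 0) + (if w \<in> {v, y} then 1 else 0)"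
      unfolding switch_def by (rule card_switch_filter) (use f(5-14) fE in \<open>simp_all add: doubleton_eq_iff\<close>)
    moreover have "card {e \<in> E. w \<in> e} = d" using E that by (auto simp: regular_graphs_def)
    moreover have "(if w \<in> {u, v} then 1 else 0) + (if w \<in> {x, y} then 1 else 0)
       = (if w \<in> {u, x} then 1 else 0) + (if w \<in> {v, y} then 1 else (0::nat))"
    proof -
      have "(if w \<in> {a, b} then 1 else 0) = (if w = a then 1 else 0) + (if w = b then 1 else (0::nat))"
        if "a \<noteq> b" for a b using that by auto
      then show ?thesis using f(9,10,11,14) by simp
    qed
    ultimately show ?thesis by linarith
  qed
  ultimately show ?thesis by (simp add: regular_graphs_def)
qed

lemma arcs_switch: "arcs (switch E u v x y) A B = arcs E A B \<union> {(u, x), (v, y)}"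
proof -
  note f = switch_facts
  have "{a, b} \<noteq> {u, v}" "{a, b} \<noteq> {x, y}" if "a \<in> A" "b \<in> B" for a b
    using f(1-4) that B by (auto simp: doubleton_eq_iff)
  moreover have "{a, b} = {u, x} \<longleftrightarrow> (a, b) = (u, x)" "{a, b} = {v, y} \<longleftrightarrow> (a, b) = (v, y)"
    if "a \<in> A" "b \<in> B" for a b
    using f(1-4) that B by (auto simp: doubleton_eq_iff)
  ultimately show ?thesis using f(1-4) unfolding switch_def arcs_def by auto
qed

lemma card_arcs_switch: "card (arcs (switch E u v x y) A B) = card (arcs E A B) + 2"
proof -
  have "finite A" "finite B" using A B finite_subset by auto
  moreover have "(u, x) \<notin> arcs E A B" "(v, y) \<notin> arcs E A B"
    using switch_facts(7,8) by (simp_all add: arcs_def)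
  ultimately show ?thesis unfolding arcs_switch using switch_facts(9) by simp
qed

lemma switch_inverse: "E = (switch E u v x y - {{u, x}, {v, y}}) \<union> {{u, v}, {x, y}}"
  using switch_facts(5-8) unfolding switch_def by blast

end

section \<open>Counting switchings in both directions\<close>

text \<open>A pair of arcs, one inside A and one outside, is blocked only if ux or vy is already an
  edge. Such a pair is determined by that cut edge and one neighbour of each of its ends, so each of
  the two reasons blocks at most c d^2 pairs.\<close>

lemma card_switchings_ge:
  assumes A: "A \<subseteq> {1..n}" and E: "E \<in> cut_graphs n d A c"
  shows "(real d * real (card A) - real c) * (real d * (real n - real (card A)) - real c)
     - 2 * real c * (real d)\<^sup>2 \<le> real (card (switchings E A ({1..n} - A)))"
proof -
  let ?V = "{1..n}"
  define B where "B = ?V - A"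
  have B: "B \<subseteq> ?V" "?V - B = A" using A B_def by auto
  have fin: "finite A" "finite B" using A B finite_subset by auto
  have R: "E \<in> regular_graphs n d" and c: "card (arcs E A B) = c"
    using E by (auto simp: cut_graphs_def B_def)
  have c': "card (arcs E B A) = c" using c card_arcs_commute by metis
  have cB: "card B = n - card A" "card A \<le> n"
    using A fin card_mono[OF _ A] by (auto simp: B_def card_Diff_subset)
  have AA: "real (card (arcs E A A)) = real d * real (card A) - real c"
    using card_arcs_split[OF R A] c unfolding B_def[symmetric] by (metis add_diff_cancel_right' of_nat_add of_nat_mult)
  have BB: "real (card (arcs E B B)) = real d * (real n - real (card A)) - real c"
    using card_arcs_split[OF R B(1)] c' cB unfolding B(2)
    by (metis add_diff_cancel_right' of_nat_add of_nat_mult of_nat_diff)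
  define N where "N v = {w \<in> ?V. {v, w} \<in> E}" for v
  have cN: "card (N v) = d" "finite (N v)" if "v \<in> ?V" for v
    using card_neighbours[OF R that] by (auto simp: N_def)
  define T where "T = Sigma (arcs E A B) (\<lambda>(u, x). N u \<times> N x)"
  have "card T = (\<Sum>p\<in>arcs E A B. card (case p of (u, x) \<Rightarrow> N u \<times> N x))"
    unfolding T_def using fin by (intro card_SigmaI) (auto simp: N_def)
  also have "\<dots> = (\<Sum>p\<in>arcs E A B. d * d)"
  proof (intro sum.cong refl)
    fix p assume "p \<in> arcs E A B"
    then obtain u x where p: "p = (u, x)" "u \<in> A" "x \<in> B" by (auto simp: arcs_def)
    then have "u \<in> ?V" "x \<in> ?V" using A B(1) by blast+
    then show "card (case p of (u, x) \<Rightarrow> N u \<times> N x) = d * d"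
      using cN(1) p(1) by (simp only: prod.case card_cartesian_product)
  qed
  finally have cT: "card T = c * d\<^sup>2" using c by (simp add: power2_eq_square)
  have fT: "finite T" unfolding T_def using fin by (auto simp: N_def)
  define f1 :: "(nat \<times> nat) \<times> (nat \<times> nat) \<Rightarrow> (nat \<times> nat) \<times> (nat \<times> nat)"
    where "f1 = (\<lambda>((u, x), (v, y)). ((u, v), (x, y)))"
  define f2 :: "(nat \<times> nat) \<times> (nat \<times> nat) \<Rightarrow> (nat \<times> nat) \<times> (nat \<times> nat)"
    where "f2 = (\<lambda>((v, y), (u, x)). ((u, v), (x, y)))"
  have "arcs E A A \<times> arcs E B B \<subseteq> switchings E A B \<union> f1 ` T \<union> f2 ` T"
  proof
    fix s assume s: "s \<in> arcs E A A \<times> arcs E B B"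
    then obtain u v x y where uvxy: "s = ((u, v), (x, y))" "(u, v) \<in> arcs E A A" "(x, y) \<in> arcs E B B"
      by auto
    have uV: "u \<in> A" "v \<in> A" "x \<in> B" "y \<in> B" "u \<in> ?V" "v \<in> ?V" "x \<in> ?V" "y \<in> ?V"
      using uvxy A B(1) by (auto simp: arcs_def simp del: atLeastAtMost_iff)
    have in_T: "((u, x), (v, y)) \<in> T" if "{u, x} \<in> E"
      using that uvxy(2,3) uV by (simp add: T_def N_def arcs_def)
    have in_T': "((v, y), (u, x)) \<in> T" if "{v, y} \<in> E"
      using that uvxy(2,3) uV by (simp add: T_def N_def arcs_def insert_commute)
    show "s \<in> switchings E A B \<union> f1 ` T \<union> f2 ` T"
    proof (cases "{u, x} \<in> E \<or> {v, y} \<in> E")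
      case True
      then show ?thesis
      proof
        assume "{u, x} \<in> E"
        then have "f1 ((u, x), (v, y)) \<in> f1 ` T" using in_T by blast
        then show ?thesis by (simp add: f1_def uvxy)
      next
        assume "{v, y} \<in> E"
        then have "f2 ((v, y), (u, x)) \<in> f2 ` T" using in_T' by blast
        then show ?thesis by (simp add: f2_def uvxy)
      qed
    qed (use uvxy in \<open>auto simp: switchings_def\<close>)
  qed
  moreover have fS: "finite (switchings E A B)"
    by (rule finite_subset[of _ "arcs E A A \<times> arcs E B B"]) (use fin in \<open>auto simp: switchings_def\<close>)
  ultimately have "card (arcs E A A \<times> arcs E B B) \<le> card (switchings E A B \<union> f1 ` T \<union> f2 ` T)"
    using fT by (intro card_mono) auto
  also have "\<dots> \<le> card (switchings E A B) + card (f1 ` T) + card (f2 ` T)"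
    by (meson card_Un_le order_trans add_le_mono1)
  also have "\<dots> \<le> card (switchings E A B) + card T + card T"
    using fT by (intro add_mono card_image_le) auto
  finally have "card (arcs E A A) * card (arcs E B B) \<le> card (switchings E A B) + 2 * (c * d\<^sup>2)"
    unfolding cT card_cartesian_product by simp
  then have "real (card (arcs E A A)) * real (card (arcs E B B)) \<le> real (card (switchings E A B)) + 2 * (real c * (real d)\<^sup>2)"
    by (metis (mono_tags, lifting) of_nat_add of_nat_le_iff of_nat_mult of_nat_numeral of_nat_power)
  then show ?thesis unfolding AA BB B_def[symmetric] by simp
qed

text \<open>Double counting: the original graph is recovered from the switched one and the ordered
  pair of new cut edges, for which there are (c + 2)(c + 1) choices.\<close>

lemma switching_inequality:
  assumes A: "A \<subseteq> {1..n}"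
  shows "real (card (cut_graphs n d A c)) *
     ((real d * real (card A) - real c) * (real d * (real n - real (card A)) - real c) - 2 * real c * (real d)\<^sup>2)
     \<le> real (card (cut_graphs n d A (c + 2))) * ((real c + 1) * (real c + 2))"
proof -
  let ?F = "(real d * real (card A) - real c) * (real d * (real n - real (card A)) - real c) - 2 * real c * (real d)\<^sup>2"
  define B where "B = {1..n} - A"
  have fin: "finite A" "finite B" using A B_def finite_subset by auto
  have fG: "finite (cut_graphs n d A c')" for c' by (simp add: cut_graphs_def)
  define S where "S = Sigma (cut_graphs n d A c) (\<lambda>E. switchings E A B)"
  define T where "T = Sigma (cut_graphs n d A (c + 2))
     (\<lambda>E. Sigma (arcs E A B) (\<lambda>p. arcs E A B - {p}))"
  define f :: "nat set set \<times> (nat \<times> nat) \<times> (nat \<times> nat) \<Rightarrow> nat set set \<times> (nat \<times> nat) \<times> (nat \<times> nat)"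
    where "f = (\<lambda>(E, (u, v), (x, y)). (switch E u v x y, (u, x), (v, y)))"
  have fS: "finite (switchings E A B)" for E
    by (rule finite_subset[of _ "arcs E A A \<times> arcs E B B"]) (use fin in \<open>auto simp: switchings_def\<close>)
  have cut_arcs: "card (arcs E A B) = c'" if "E \<in> cut_graphs n d A c'" for E c'
    using that by (auto simp: cut_graphs_def B_def)
  have inj: "inj_on f S"
  proof (rule inj_onI)
    fix s t assume s: "s \<in> S" and t: "t \<in> S" and eq: "f s = f t"
    obtain E1 u v x y where s': "s = (E1, (u, v), (x, y))" by (metis surj_pair)
    obtain E2 u' v' x' y' where t': "t = (E2, (u', v'), (x', y'))" by (metis surj_pair)
    have e: "u = u'" "v = v'" "x = x'" "y = y'" "switch E1 u v x y = switch E2 u v x y"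
      using eq unfolding s' t' f_def by auto
    have "E1 \<in> regular_graphs n d" "E2 \<in> regular_graphs n d"
       "((u, v), (x, y)) \<in> switchings E1 A B" "((u, v), (x, y)) \<in> switchings E2 A B"
      using s t e unfolding s' t' S_def by (auto simp: cut_graphs_def)
    then have "E1 = E2" using switch_inverse[OF A B_def] e(5) by metis
    then show "s = t" using e unfolding s' t' by simp
  qed
  have sub: "f ` S \<subseteq> T"
  proof
    fix t assume "t \<in> f ` S"
    then obtain E u v x y where E: "E \<in> cut_graphs n d A c" and sw: "((u, v), (x, y)) \<in> switchings E A B"
      and t: "t = (switch E u v x y, (u, x), (v, y))"
      unfolding S_def f_def by auto
    have R: "E \<in> regular_graphs n d" using E by (simp add: cut_graphs_def)
    have "switch E u v x y \<in> cut_graphs n d A (c + 2)"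
      using switch_regular[OF A B_def R sw] card_arcs_switch[OF A B_def R sw] cut_arcs[OF E]
      by (simp add: cut_graphs_def B_def)
    then show "t \<in> T" using arcs_switch[OF A B_def R sw] switch_facts(9)[OF A B_def R sw]
      by (auto simp: T_def t)
  qed
  have finT: "finite T" unfolding T_def using fG fin by auto
  have "card T = (\<Sum>E\<in>cut_graphs n d A (c + 2). card (Sigma (arcs E A B) (\<lambda>p. arcs E A B - {p})))"
    unfolding T_def using fG fin by (intro card_SigmaI) auto
  also have "\<dots> = (\<Sum>E\<in>cut_graphs n d A (c + 2). (c + 2) * (c + 1))"
  proof (intro sum.cong refl)
    fix E assume E: "E \<in> cut_graphs n d A (c + 2)"
    have "card (Sigma (arcs E A B) (\<lambda>p. arcs E A B - {p})) = (\<Sum>p\<in>arcs E A B. card (arcs E A B - {p}))"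
      using fin by (intro card_SigmaI) auto
    also have "\<dots> = (\<Sum>p\<in>arcs E A B. c + 1)" using cut_arcs[OF E] by (intro sum.cong refl) auto
    finally show "card (Sigma (arcs E A B) (\<lambda>p. arcs E A B - {p})) = (c + 2) * (c + 1)"
      using cut_arcs[OF E] by simp
  qed
  finally have cT: "card T = card (cut_graphs n d A (c + 2)) * ((c + 2) * (c + 1))" by simp
  have "real (card (cut_graphs n d A c)) * ?F = (\<Sum>E\<in>cut_graphs n d A c. ?F)" by simp
  also have "\<dots> \<le> (\<Sum>E\<in>cut_graphs n d A c. real (card (switchings E A B)))"
    unfolding B_def by (intro sum_mono card_switchings_ge A)
  also have "\<dots> = real (card S)"
    unfolding S_def using fG fS by (subst card_SigmaI) auto
  also have "\<dots> \<le> real (card T)"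
    using card_mono[OF finT sub] card_image[OF inj] by simp
  also have "\<dots> = real (card (cut_graphs n d A (c + 2))) * ((real c + 1) * (real c + 2))"
    unfolding cT by (simp add: algebra_simps)
  finally show ?thesis .
qed

text \<open>\<open>fwd\<close> bounds from below the switchings that lead out of a graph with c
  boundary edges; \<open>bwd\<close> bounds from above those that lead into a graph with c +
  2.\<close>

definition fwd :: "nat \<Rightarrow> nat \<Rightarrow> nat \<Rightarrow> nat \<Rightarrow> real" where
  "fwd n d a c = (real d * real a - real c) * (real d * (real n - real a) - real c) - 2 * real c * (real d)\<^sup>2"

definition bwd :: "nat \<Rightarrow> real" where "bwd c = (real c + 1) * (real c + 2)"

lemma card_cut_graphs_le:
  assumes A: "A \<subseteq> {1..n}" and pos: "\<And>i. i < m \<Longrightarrow> 0 < fwd n d (card A) (c + 2 * i)"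
  shows "real (card (cut_graphs n d A c)) \<le>
     real (card (regular_graphs n d)) * (\<Prod>i<m. bwd (c + 2 * i) / fwd n d (card A) (c + 2 * i))"
proof -
  have "real (card (cut_graphs n d A c)) \<le>
     real (card (cut_graphs n d A (c + 2 * j))) * (\<Prod>i<j. bwd (c + 2 * i) / fwd n d (card A) (c + 2 * i))"
    if "j \<le> m" for j
    using that
  proof (induction j)
    case (Suc j)
    have F: "0 < fwd n d (card A) (c + 2 * j)" using pos Suc.prems by simp
    have "real (card (cut_graphs n d A (c + 2 * j))) * fwd n d (card A) (c + 2 * j)
       \<le> real (card (cut_graphs n d A (c + 2 * Suc j))) * bwd (c + 2 * j)"
      using switching_inequality[OF A, of d "c + 2 * j"] by (simp add: fwd_def bwd_def)
    then have *: "real (card (cut_graphs n d A (c + 2 * j)))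
       \<le> real (card (cut_graphs n d A (c + 2 * Suc j))) * (bwd (c + 2 * j) / fwd n d (card A) (c + 2 * j))"
      using F by (simp add: field_simps)
    have "0 \<le> (\<Prod>i<j. bwd (c + 2 * i) / fwd n d (card A) (c + 2 * i))"
    proof (rule prod_nonneg)
      fix i assume "i \<in> {..<j}"
      then show "0 \<le> bwd (c + 2 * i) / fwd n d (card A) (c + 2 * i)"
        using pos[of i] Suc.prems by (simp add: bwd_def)
    qed
    from mult_right_mono[OF * this] Suc show ?case by (simp add: mult_ac)
  qed simp
  from this[of m] have "real (card (cut_graphs n d A c)) \<le>
     real (card (cut_graphs n d A (c + 2 * m))) * (\<Prod>i<m. bwd (c + 2 * i) / fwd n d (card A) (c + 2 * i))"
    by simp
  also have "\<dots> \<le> real (card (regular_graphs n d)) * (\<Prod>i<m. bwd (c + 2 * i) / fwd n d (card A) (c + 2 * i))"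
  proof (rule mult_right_mono)
    show "real (card (cut_graphs n d A (c + 2 * m))) \<le> real (card (regular_graphs n d))"
      by (auto simp: cut_graphs_def intro!: card_mono)
    show "0 \<le> (\<Prod>i<m. bwd (c + 2 * i) / fwd n d (card A) (c + 2 * i))"
      using pos by (intro prod_nonneg) (auto simp: bwd_def intro: less_imp_le)
  qed
  finally show ?thesis .
qed

section \<open>First moment estimates\<close>

lemma prod_falling:
  assumes "m \<le> N" shows "(\<Prod>j<m. real N - real j) = fact N / fact (N - m)"
  using assms
proof (induction m)
  case (Suc m)
  have f: "fact (N - m) = real (N - m) * fact (N - Suc m)"
    using Suc.prems by (metis Suc_diff_Suc Suc_le_lessD fact_Suc of_nat_fact of_nat_mult)
  have "(\<Prod>j<Suc m. real N - real j) = fact N / fact (N - m) * real (N - m)"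
    using Suc by (simp add: of_nat_diff)
  also have "\<dots> = fact N / fact (N - Suc m)" unfolding f using Suc.prems by simp
  finally show ?case .
qed simp

lemma binomial_eq_prod:
  assumes "a \<le> n" shows "real (n choose a) = (\<Prod>j<a. (real n - real j) / (real j + 1))"
proof -
  have "(\<Prod>j<a. real j + 1) = fact a" by (induction a) (simp_all add: algebra_simps)
  then show ?thesis using assms prod_falling[OF assms]
    by (simp add: prod_dividef binomial_fact field_simps)
qed

text \<open>The product of the factors 3a, 3a - 2, ..., a + 2 that occur in the denominators of the
  switching ratios.\<close>

definition cubic_prod :: "nat \<Rightarrow> real" where
  "cubic_prod a = (\<Prod>j<a. 3 * real a - 2 * real j)"

text \<open>Its square is the binomial coefficient times the product of the ratios
  \<open>qterm\<close> in the extremal case n = 2a.\<close>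

definition half_ratio :: "nat \<Rightarrow> real" where
  "half_ratio a = fact (2 * a) / (fact a * cubic_prod a)"

lemma cubic_prod_pos: "0 < cubic_prod a"
  unfolding cubic_prod_def by (intro prod_pos) auto

text \<open>The factors descend in steps of two, so a is compared with a + 2 rather than a + 1:
  three factors enter at the top and a + 2 drops out at the bottom.\<close>

lemma cubic_prod_add_2:
  "cubic_prod (a + 2) * (real a + 2) = (3 * real a + 6) * (3 * real a + 4) * (3 * real a + 2) * cubic_prod a"
proof -
  define g where "g j = 3 * real (a + 2) - 2 * real j" for j
  have "cubic_prod (a + 2) * g (a + 2) = (\<Prod>j<Suc (a + 2). g j)"
    by (simp add: cubic_prod_def g_def)
  also have "\<dots> = g 0 * (g 1 * (g 2 * (\<Prod>j<a. g (Suc (Suc (Suc j))))))"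
    unfolding prod.lessThan_Suc_shift add_2_eq_Suc' by (simp add: prod.lessThan_Suc_shift numeral_2_eq_2)
  also have "(\<Prod>j<a. g (Suc (Suc (Suc j)))) = cubic_prod a"
    unfolding cubic_prod_def g_def by (intro prod.cong) auto
  finally show ?thesis by (simp add: g_def algebra_simps)
qed

text \<open>The quotient approaches 16/27 from below as a grows.\<close>

lemma half_ratio_add_2: "half_ratio (a + 2) \<le> 16 / 27 * half_ratio a"
proof -
  define x where "x = real a"
  have x: "0 \<le> x" by (simp add: x_def)
  have f2: "fact (2 * (a + 2)) = (2 * x + 4) * (2 * x + 3) * (2 * x + 2) * (2 * x + 1) * (fact (2 * a) :: real)"
    unfolding x_def by (simp add: algebra_simps numeral_eq_Suc)
  have f1: "fact (a + 2) = (x + 2) * (x + 1) * (fact a :: real)"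
    unfolding x_def by (simp add: algebra_simps numeral_eq_Suc)
  have W: "cubic_prod (a + 2) = (3 * x + 6) * (3 * x + 4) * (3 * x + 2) * cubic_prod a / (x + 2)"
    using cubic_prod_add_2[of a] x unfolding x_def by (simp add: field_simps)
  have "half_ratio (a + 2) = half_ratio a * (4 / 3 * (2 * x + 3) * (2 * x + 1) / ((3 * x + 4) * (3 * x + 2)))"
  proof -
    have nz: "x + 2 \<noteq> 0" "x + 1 \<noteq> 0" "3 * x + 4 \<noteq> 0" "3 * x + 2 \<noteq> 0" using x by linarith+
    have e: "3 * x + 6 = 3 * (x + 2)" "2 * x + 4 = 2 * (x + 2)" "2 * x + 2 = 2 * (x + 1)" by simp_all
    show ?thesis unfolding half_ratio_def f2 f1 W e using nz cubic_prod_pos[of a]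
      by (simp add: divide_simps) (simp add: algebra_simps)
  qed
  also have "\<dots> \<le> half_ratio a * (16 / 27)"
  proof (rule mult_left_mono)
    have "27 * (4 * ((2 * x + 3) * (2 * x + 1))) \<le> 16 * (3 * ((3 * x + 4) * (3 * x + 2)))"
      by (simp add: algebra_simps)
    then have "4 / 3 * (2 * x + 3) * (2 * x + 1) \<le> 16 / 27 * ((3 * x + 4) * (3 * x + 2))"
      by (simp add: field_simps)
    moreover have "0 < (3 * x + 4) * (3 * x + 2)" using x by simp
    ultimately show "4 / 3 * (2 * x + 3) * (2 * x + 1) / ((3 * x + 4) * (3 * x + 2)) \<le> 16 / 27"
      by (simp only: pos_divide_le_eq)
    show "0 \<le> half_ratio a" unfolding half_ratio_def using cubic_prod_pos[of a] by simp
  qed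
  finally show ?thesis by simp
qed

lemma half_ratio_square_le: "(half_ratio a)\<^sup>2 \<le> (16 / 27) ^ a"
proof (induction a rule: induct_nat_012)
  case 0 show ?case by (simp add: half_ratio_def cubic_prod_def)
next
  case 1 show ?case by (simp add: half_ratio_def cubic_prod_def power2_eq_square)
next
  case (ge2 a)
  have "0 \<le> half_ratio (a + 2)" unfolding half_ratio_def using cubic_prod_pos[of "a + 2"] by simp
  then have "(half_ratio (a + 2))\<^sup>2 \<le> (16 / 27 * half_ratio a)\<^sup>2"
    using half_ratio_add_2 by (intro power_mono)
  also have "\<dots> = (16 / 27)\<^sup>2 * (half_ratio a)\<^sup>2" by (rule power_mult_distrib)
  also have "\<dots> \<le> (16 / 27)\<^sup>2 * (16 / 27) ^ a" using ge2 by (intro mult_left_mono) auto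
  finally show ?case by (simp add: power2_eq_square)
qed

text \<open>The worst case d = 3, c = 0 of the ratio of consecutive switching counts.\<close>

definition qterm :: "nat \<Rightarrow> nat \<Rightarrow> nat \<Rightarrow> real" where
  "qterm n a j = (2 * real j + 1) * (2 * real j + 2) / ((3 * real a - 2 * real j) * (3 * (real n - real a) - 2 * real j))"

text \<open>After pairing the j-th factor of the binomial coefficient with the j-th ratio, n occurs
  only in (n - j) / (3 (n - a) - 2j). This decreases in n, so n = 2a is the worst case.\<close>

lemma binomial_prod_qterm_le:
  assumes a: "2 * a \<le> n"
  shows "real (n choose a) * (\<Prod>j<a. qterm n a j) \<le> (16 / 27) ^ a"
proof -
  have "real (n choose a) * (\<Prod>j<a. qterm n a j) = (\<Prod>j<a. (real n - real j) / (real j + 1) * qterm n a j)"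
    using a by (simp add: binomial_eq_prod flip: prod.distrib)
  also have "\<dots> \<le> (\<Prod>j<a. (2 * (2 * real j + 1)) * (2 * real a - real j) / (3 * real a - 2 * real j)\<^sup>2)"
  proof (rule prod_mono, safe)
    fix j assume j: "j < a"
    define x where "x = real j"
    define y where "y = real a"
    define s where "s = real n - 2 * y"
    have xys: "0 \<le> x" "x < y" "0 \<le> s" using j a unfolding x_def y_def s_def by auto
    have n: "real n = 2 * y + s" by (simp add: s_def)
    have pos: "0 < 3 * y - 2 * x" "0 < 3 * (2 * y + s - y) - 2 * x" "0 \<le> 2 * y + s - x" "0 \<le> 2 * y - x" using xys by auto
    show "0 \<le> (real n - real j) / (real j + 1) * qterm n a j"
      unfolding qterm_def n x_def[symmetric] y_def[symmetric] using pos xys by simp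
    have "(2 * y + s - x) * (3 * y - 2 * x) \<le> (2 * y - x) * (3 * (2 * y + s - y) - 2 * x)"
    proof -
      have "(2 * y - x) * (3 * (2 * y + s - y) - 2 * x) - (2 * y + s - x) * (3 * y - 2 * x) = s * (3 * y - x)"
        by (simp add: algebra_simps)
      moreover have "0 \<le> s * (3 * y - x)" using xys by simp
      ultimately show ?thesis by linarith
    qed
    then have *: "(2 * y + s - x) / (3 * (2 * y + s - y) - 2 * x) \<le> (2 * y - x) / (3 * y - 2 * x)"
      using pos by (simp add: pos_divide_le_eq pos_le_divide_eq)
    have "(real n - real j) / (real j + 1) * qterm n a j
       = (2 * (2 * x + 1)) / (3 * y - 2 * x) * ((2 * y + s - x) / (3 * (2 * y + s - y) - 2 * x))"
      unfolding qterm_def n x_def[symmetric] y_def[symmetric] using pos(1,2) xys(1)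
      by (simp add: divide_simps) (simp add: algebra_simps)
    also have "\<dots> \<le> (2 * (2 * x + 1)) / (3 * y - 2 * x) * ((2 * y - x) / (3 * y - 2 * x))"
      using * pos xys by (intro mult_left_mono) auto
    finally show "(real n - real j) / (real j + 1) * qterm n a j
       \<le> (2 * (2 * real j + 1)) * (2 * real a - real j) / (3 * real a - 2 * real j)\<^sup>2"
      unfolding x_def y_def by (simp add: power2_eq_square)
  qed
  also have "\<dots> = (half_ratio a)\<^sup>2"
  proof -
    have 1: "(\<Prod>j<a. 2 * (2 * real j + 1)) = fact (2 * a) / fact a"
    proof (induction a)
      case (Suc a)
      have f2: "fact (2 * Suc a) = (2 * (real a + 1)) * ((2 * real a + 1) * fact (2 * a))"
        by (simp add: algebra_simps)
      have f1: "fact (Suc a) = (real a + 1) * fact a" by (simp add: algebra_simps)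
      have cancel: "(2 * y) * (x * G) / (y * F) = G / F * (2 * x)" if "y \<noteq> 0" for x y F G :: real
        using that by simp
      have "(\<Prod>j<Suc a. 2 * (2 * real j + 1)) = fact (2 * a) / fact a * (2 * (2 * real a + 1))"
        using Suc by simp
      also have "\<dots> = fact (2 * Suc a) / fact (Suc a)"
        unfolding f1 f2 by (rule cancel[symmetric]) simp
      finally show ?case .
    qed simp
    have 2: "(\<Prod>j<a. 2 * real a - real j) = fact (2 * a) / fact a"
      using prod_falling[of a "2 * a"] by simp
    show ?thesis unfolding half_ratio_def
      by (simp only: prod_dividef prod.distrib[of "\<lambda>j. 2 * (2 * real j + 1)" "\<lambda>j. 2 * real a - real j"]
          prod_power_distrib[symmetric] 1 2 cubic_prod_def[symmetric])
        (simp add: power2_eq_square)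
  qed
  also have "\<dots> \<le> (16 / 27) ^ a" by (rule half_ratio_square_le)
  finally show ?thesis .
qed

section \<open>Sets of bounded size and large sets\<close>

text \<open>An upper bound for the expected number of a-sets with c boundary edges, once all the
  values of \<open>fwd\<close> are positive.\<close>

definition expected :: "nat \<Rightarrow> nat \<Rightarrow> nat \<Rightarrow> nat \<Rightarrow> real" where
  "expected n d a c = real (n choose a) * (\<Prod>i<a + 1. bwd (c + 2 * i) / fwd n d a (c + 2 * i))"

lemma binomial_le_power: "real (n choose a) \<le> real n ^ a"
proof (cases "a \<le> n")
  case True
  have "real (n choose a) = (\<Prod>j<a. (real n - real j) / (real j + 1))" by (rule binomial_eq_prod[OF True])
  also have "\<dots> \<le> (\<Prod>j<a. real n)"
  proof (rule prod_mono, safe)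
    fix j assume "j < a"
    then have "real j \<le> real n" using True by simp
    then show "0 \<le> (real n - real j) / (real j + 1)" by simp
    have "real n * 1 \<le> real n * (real j + 1)" by (intro mult_left_mono) auto
    then show "(real n - real j) / (real j + 1) \<le> real n"
      by (simp add: pos_divide_le_eq)
  qed
  finally show ?thesis by simp
qed (simp add: binomial_eq_0)

text \<open>As c + 2a < d a, an arc inside A is still left at each of the a + 1 switchings, and
  about 3n/2 or more arcs are available outside. So every \<open>fwd\<close> is at least n, and at
  most n^a sets meet a + 1 factors of order 1/n.\<close>

lemma expected_small:
  assumes d: "3 \<le> d" and c: "c + 2 * a \<le> K" and ac: "c + 2 * a < d * a" and a: "2 * a \<le> n" "1 \<le> a"
    and n: "2 * real K * (1 + 2 * (real d)\<^sup>2) \<le> real n" "K \<le> n" "0 < n"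
  shows "i \<le> a \<Longrightarrow> 0 < fwd n d a (c + 2 * i)"
    and "expected n d a c \<le> (real K + 2) ^ (2 * (a + 1)) / real n"
proof -
  have fwd_ge: "real n \<le> fwd n d a (c + 2 * i)" if "i \<le> a" for i
  proof -
    define c' where "c' = c + 2 * i"
    have c': "c' \<le> K" "c' + 1 \<le> d * a" using c ac that unfolding c'_def by linarith+
    have 1: "1 \<le> real d * real a - real c'"
    proof -
      have "real c' + 1 \<le> real d * real a" using c'(2) by (metis of_nat_1 of_nat_add of_nat_le_iff of_nat_mult)
      then show ?thesis by simp
    qed
    have "3 * (real n / 2) \<le> real d * (real n - real a)"
      using d a by (intro mult_mono) auto
    then have 2: "3 * (real n / 2) - real K \<le> real d * (real n - real a) - real c'" using c' by simp
    have 3: "0 \<le> 3 * (real n / 2) - real K" using n by simp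
    define P where "P = (real d * real a - real c') * (real d * (real n - real a) - real c')"
    define Z where "Z = 2 * real c' * (real d)\<^sup>2"
    have "1 * (3 * (real n / 2) - real K) \<le> P"
      unfolding P_def using 1 2 3 by (intro mult_mono) auto
    moreover have "Z \<le> 2 * real K * (real d)\<^sup>2"
      unfolding Z_def using c' by (intro mult_right_mono) auto
    moreover have "real n \<le> 3 * (real n / 2) - real K - 2 * real K * (real d)\<^sup>2"
      using n(1) by (simp add: algebra_simps)
    ultimately have "real n \<le> P - Z" by simp
    then show ?thesis unfolding fwd_def c'_def[symmetric] P_def Z_def .
  qed
  show pos: "0 < fwd n d a (c + 2 * i)" if "i \<le> a" for i using fwd_ge[OF that] n(3) by linarith
  have "(\<Prod>i<a + 1. bwd (c + 2 * i) / fwd n d a (c + 2 * i)) \<le> (\<Prod>i<a + 1. (real K + 2)\<^sup>2 / real n)"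
  proof (rule prod_mono, safe)
    fix i assume "i < a + 1"
    then have i: "i \<le> a" by simp
    show "0 \<le> bwd (c + 2 * i) / fwd n d a (c + 2 * i)" using pos[OF i] by (simp add: bwd_def)
    have "real (c + 2 * i) \<le> real K" using i c by (intro of_nat_mono) linarith
    then have "bwd (c + 2 * i) \<le> (real K + 2) * (real K + 2)"
      unfolding bwd_def by (intro mult_mono) auto
    then show "bwd (c + 2 * i) / fwd n d a (c + 2 * i) \<le> (real K + 2)\<^sup>2 / real n"
      using fwd_ge[OF i] n(3) by (intro frac_le) (auto simp: power2_eq_square)
  qed
  then have le: "(\<Prod>i<a + 1. bwd (c + 2 * i) / fwd n d a (c + 2 * i)) \<le> ((real K + 2)\<^sup>2 / real n) ^ (a + 1)"
    by (simp only: prod_constant card_lessThan)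
  have "0 \<le> (\<Prod>i<a + 1. bwd (c + 2 * i) / fwd n d a (c + 2 * i))"
  proof (rule prod_nonneg)
    fix i assume "i \<in> {..<a + 1}"
    then show "0 \<le> bwd (c + 2 * i) / fwd n d a (c + 2 * i)" using pos[of i] by (simp add: bwd_def)
  qed
  then have "expected n d a c \<le> real n ^ a * ((real K + 2)\<^sup>2 / real n) ^ (a + 1)"
    unfolding expected_def by (intro mult_mono binomial_le_power le) auto
  also have "\<dots> = (real K + 2) ^ (2 * (a + 1)) / real n"
    unfolding power_divide power_mult[symmetric] using n(3) by simp
  finally show "expected n d a c \<le> (real K + 2) ^ (2 * (a + 1)) / real n" .
qed

text \<open>Put j = c + i. Since c + 2i <= 2j, the i-th ratio is at most 5/4 times
  \<open>qterm\<close> at j, where 5/4 pays for blocked switchings; 4C < a keeps the denominators of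
  order a and n up to j = a + C. The loss is affordable because 5/4 * 16/27 = 20/27 is below
  1.\<close>

lemma expected_large:
  assumes d: "3 \<le> d" and c: "c \<le> C" and a: "4 * C + 1 \<le> a" "2 * a \<le> n"
    and n: "320 * (real d)\<^sup>2 \<le> real n"
  shows "i \<le> a \<Longrightarrow> 0 < fwd n d a (c + 2 * i)"
    and "expected n d a c \<le> 5 / 4 * 1200 ^ (C + 1) * (real a ^ (2 * C + 1) * (20 / 27) ^ a) / real n"
proof -
  have a1: "1 \<le> real a" "4 * real C \<le> real a" "2 * real a \<le> real n" "real c \<le> real C" "0 < real n"
    using a c by auto
  have den: "real a / 2 \<le> 3 * real a - 2 * real j" "real n / 4 \<le> 3 * (real n - real a) - 2 * real j"
    "real j \<le> 2 * real a" if "j \<le> a + C" for j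
  proof -
    have "real j \<le> real a + real C" using that by (metis of_nat_add of_nat_le_iff)
    then show "real a / 2 \<le> 3 * real a - 2 * real j" "real n / 4 \<le> 3 * (real n - real a) - 2 * real j"
      "real j \<le> 2 * real a" using a1 by (simp_all add: field_simps)
  qed
  have fwd_ge: "4 / 5 * ((3 * real a - 2 * real (c + i)) * (3 * (real n - real a) - 2 * real (c + i)))
      \<le> fwd n d a (c + 2 * i)" if i: "i \<le> a" for i
  proof -
    define j where "j = c + i"
    define c' where "c' = c + 2 * i"
    have j: "j \<le> a + C" "real c' \<le> 2 * real j" using i c unfolding j_def c'_def by auto
    define P where "P = (3 * real a - 2 * real j) * (3 * (real n - real a) - 2 * real j)"
    have "(real a / 2) * (real n / 4) \<le> P"
      unfolding P_def using den[OF j(1)] by (intro mult_mono) auto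
    moreover define R where "R = (real d * real a - real c') * (real d * (real n - real a) - real c')"
    define Z where "Z = 2 * real c' * (real d)\<^sup>2"
    have "P \<le> R"
      unfolding P_def R_def
    proof (rule mult_mono)
      have "3 * real a \<le> real d * real a" using d by (intro mult_right_mono) auto
      then show "3 * real a - 2 * real j \<le> real d * real a - real c'" using j by linarith
      then show "0 \<le> real d * real a - real c'" using den(1)[OF j(1)] a1 by linarith
      have "3 * (real n - real a) \<le> real d * (real n - real a)" using d a1 by (intro mult_right_mono) auto
      then show "3 * (real n - real a) - 2 * real j \<le> real d * (real n - real a) - real c'" using j by linarith
      show "0 \<le> 3 * (real n - real a) - 2 * real j" using den(2)[OF j(1)] a1 by linarith
    qed
    moreover have "Z \<le> real a * real n / 40"
      \<comment> \<open>Blocked switchings may take at most a fifth of P >= a n / 8, that is a n /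
        40. With c + 2i <= 4a this explains the constant 320.\<close>
      unfolding Z_def
    proof -
      have "2 * real c' * (real d)\<^sup>2 \<le> 8 * real a * (real d)\<^sup>2"
        using j den(3)[OF j(1)] by (intro mult_right_mono) auto
      also have "\<dots> = real a * (320 * (real d)\<^sup>2) / 40" by simp
      also have "\<dots> \<le> real a * real n / 40" using n by (intro divide_right_mono mult_left_mono) auto
      finally show "2 * real c' * (real d)\<^sup>2 \<le> real a * real n / 40" .
    qed
    ultimately have "4 / 5 * P \<le> R - Z" by simp
    then show ?thesis unfolding fwd_def j_def[symmetric] c'_def[symmetric] P_def R_def Z_def .
  qed
  have qden: "0 < (3 * real a - 2 * real j) * (3 * (real n - real a) - 2 * real j)" if "j \<le> a + C" for j
    using den[OF that] a1 by (intro mult_pos_pos) linarith+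
  show pos: "0 < fwd n d a (c + 2 * i)" if i: "i \<le> a" for i
    using fwd_ge[OF i] qden[of "c + i"] i c by simp
  have q_pos: "0 < qterm n a j" if "j \<le> a + C" for j
    unfolding qterm_def by (rule divide_pos_pos[OF _ qden[OF that]]) (auto intro!: mult_pos_pos)
  have "(\<Prod>i<a + 1. bwd (c + 2 * i) / fwd n d a (c + 2 * i)) \<le> (\<Prod>i<a + 1. 5 / 4 * qterm n a (c + i))"
  proof (rule prod_mono, safe)
    fix i assume "i < a + 1"
    then have i: "i \<le> a" by simp
    show "0 \<le> bwd (c + 2 * i) / fwd n d a (c + 2 * i)" using pos[OF i] by (simp add: bwd_def)
    have "bwd (c + 2 * i) \<le> (2 * real (c + i) + 1) * (2 * real (c + i) + 2)"
      unfolding bwd_def by (intro mult_mono) auto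
    then have "bwd (c + 2 * i) / fwd n d a (c + 2 * i) \<le> (2 * real (c + i) + 1) * (2 * real (c + i) + 2) /
       (4 / 5 * ((3 * real a - 2 * real (c + i)) * (3 * (real n - real a) - 2 * real (c + i))))"
      using fwd_ge[OF i] qden[of "c + i"] i c by (intro frac_le) auto
    then show "bwd (c + 2 * i) / fwd n d a (c + 2 * i) \<le> 5 / 4 * qterm n a (c + i)"
      unfolding qterm_def by simp
  qed
  also have "\<dots> = (5 / 4) ^ (a + 1) * (\<Prod>i<a + 1. qterm n a (c + i))"
    by (simp only: prod.distrib prod_constant card_lessThan)
  finally have 1: "(\<Prod>i<a + 1. bwd (c + 2 * i) / fwd n d a (c + 2 * i))
     \<le> (5 / 4) ^ (a + 1) * (\<Prod>i<a + 1. qterm n a (c + i))" .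
  have split: "(\<Prod>j<x + y. qterm n a j) = (\<Prod>j<x. qterm n a j) * (\<Prod>j<y. qterm n a (x + j))" for x y
    by (induction y) (simp_all add: mult.assoc)
  \<comment> \<open>The indices run over c, ..., c + a instead of 0, ..., a - 1. The shift is undone
    by dividing by the c lowest ratios and multiplying by c + 1 highest ones, each of order a/n; the
    surplus one supplies the final 1/n.\<close>
  have eq: "(\<Prod>j<c. qterm n a j) * (\<Prod>i<a + 1. qterm n a (c + i))
      = (\<Prod>j<a. qterm n a j) * (\<Prod>i<c + 1. qterm n a (a + i))"
    unfolding split[symmetric] by (simp only: ac_simps)
  have low: "(2 / (9 * real a * real n)) ^ c \<le> (\<Prod>j<c. qterm n a j)"
  proof -
    have "(\<Prod>j<c. 2 / (9 * real a * real n)) \<le> (\<Prod>j<c. qterm n a j)"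
    proof (rule prod_mono, safe)
      fix j assume "j < c"
      then have j: "j \<le> a + C" using c by simp
      have "(3 * real a - 2 * real j) * (3 * (real n - real a) - 2 * real j) \<le> (3 * real a) * (3 * real n)"
        using den[OF j] a1 by (intro mult_mono) auto
      moreover have "(2::real) \<le> (2 * real j + 1) * (2 * real j + 2)"
        using mult_mono[of 1 "2 * real j + 1" 2 "2 * real j + 2"] by simp
      ultimately show "2 / (9 * real a * real n) \<le> qterm n a j"
        unfolding qterm_def using qden[OF j] by (intro frac_le) auto
    qed (use a1 in simp)
    then show ?thesis by simp
  qed
  have high: "(\<Prod>i<c + 1. qterm n a (a + i)) \<le> (240 * real a / real n) ^ (c + 1)"
  proof -
    have "(\<Prod>i<c + 1. qterm n a (a + i)) \<le> (\<Prod>i<c + 1. 240 * real a / real n)"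
    proof (rule prod_mono, safe)
      fix i assume "i < c + 1"
      then have j: "a + i \<le> a + C" using c by simp
      show "0 \<le> qterm n a (a + i)" using q_pos[OF j] by simp
      have "(2 * real (a + i) + 1) * (2 * real (a + i) + 2) \<le> (5 * real a) * (6 * real a)"
        using den(3)[OF j] a1(1) by (intro mult_mono) auto
      moreover have "(real a / 2) * (real n / 4) \<le> (3 * real a - 2 * real (a + i)) * (3 * (real n - real a) - 2 * real (a + i))"
        using den[OF j] by (intro mult_mono) auto
      ultimately have "qterm n a (a + i) \<le> (5 * real a) * (6 * real a) / ((real a / 2) * (real n / 4))"
        unfolding qterm_def using a1 by (intro frac_le) auto
      also have "\<dots> = 240 * real a / real n" using a1 by (simp add: field_simps)
      finally show "qterm n a (a + i) \<le> 240 * real a / real n" .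
    qed
    then show ?thesis by simp
  qed
  define Q where "Q = (\<Prod>j<a. qterm n a j)"
  have Qpos: "0 < Q" unfolding Q_def by (intro prod_pos) (auto intro: q_pos)
  have lowpos: "0 < (2 / (9 * real a * real n)) ^ c" using a1 by simp
  define L where "L = (\<Prod>j<c. qterm n a j)"
  define H where "H = (\<Prod>i<c + 1. qterm n a (a + i))"
  have L: "(2 / (9 * real a * real n)) ^ c \<le> L" using low unfolding L_def .
  have H: "H \<le> (240 * real a / real n) ^ (c + 1)" using high unfolding H_def .
  have "0 < L" using L lowpos by linarith
  moreover have "L * (\<Prod>i<a + 1. qterm n a (c + i)) = Q * H" using eq unfolding Q_def L_def H_def .
  ultimately have "(\<Prod>i<a + 1. qterm n a (c + i)) = Q * H / L" by (metis less_irrefl nonzero_mult_div_cancel_left)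
  also have "\<dots> \<le> Q * (240 * real a / real n) ^ (c + 1) / (2 / (9 * real a * real n)) ^ c"
  proof (rule frac_le)
    show "Q * H \<le> Q * (240 * real a / real n) ^ (c + 1)" using H Qpos by (intro mult_left_mono) auto
    show "0 \<le> Q * (240 * real a / real n) ^ (c + 1)" using Qpos by simp
  qed (use L lowpos in auto)
  also have "\<dots> = Q * (240 * real a / real n * ((240 * real a / real n) / (2 / (9 * real a * real n))) ^ c)"
  proof -
    have "Q * X ^ (c + 1) / Y ^ c = Q * (X * (X / Y) ^ c)" for X Y :: real by (simp add: power_divide)
    then show ?thesis .
  qed
  also have "(240 * real a / real n) / (2 / (9 * real a * real n)) = 1080 * (real a)\<^sup>2"
    using a1 by (simp add: power2_eq_square)
  \<comment> \<open>1200 is a common round bound for 240 and 1080, which lets the powers be merged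
    afterwards.\<close>
  also have "240 * real a / real n * (1080 * (real a)\<^sup>2) ^ c \<le> 1200 * real a / real n * (1200 * (real a)\<^sup>2) ^ C"
  proof (intro mult_mono)
    have "(1080 * (real a)\<^sup>2) ^ c \<le> (1200 * (real a)\<^sup>2) ^ c"
      by (intro power_mono mult_right_mono) auto
    also have "\<dots> \<le> (1200 * (real a)\<^sup>2) ^ C"
    proof (rule power_increasing[OF c])
      have "1 \<le> (real a)\<^sup>2" using a1(1) by (rule one_le_power)
      then show "1 \<le> 1200 * (real a)\<^sup>2" by simp
    qed
    finally show "(1080 * (real a)\<^sup>2) ^ c \<le> (1200 * (real a)\<^sup>2) ^ C" .
  qed (use a1 in \<open>auto intro: divide_right_mono\<close>)
  finally have 2: "(\<Prod>i<a + 1. qterm n a (c + i)) \<le> Q * (1200 * real a / real n * (1200 * (real a)\<^sup>2) ^ C)"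
    using Qpos by (simp add: mult_left_mono)
  have "expected n d a c \<le> real (n choose a) * ((5 / 4) ^ (a + 1) * (Q * (1200 * real a / real n * (1200 * (real a)\<^sup>2) ^ C)))"
    unfolding expected_def by (rule mult_left_mono[OF order_trans[OF 1 mult_left_mono[OF 2]]]) auto
  also have "\<dots> = (real (n choose a) * Q) * ((5 / 4) ^ (a + 1) * (1200 * real a / real n * (1200 * (real a)\<^sup>2) ^ C))"
    by (simp add: mult_ac)
  also have "\<dots> \<le> (16 / 27) ^ a * ((5 / 4) ^ (a + 1) * (1200 * real a / real n * (1200 * (real a)\<^sup>2) ^ C))"
    unfolding Q_def using binomial_prod_qterm_le[OF a(2)] a1 by (intro mult_right_mono) auto
  also have "\<dots> = 5 / 4 * 1200 ^ (C + 1) * (real a ^ (2 * C + 1) * ((16 / 27) ^ a * (5 / 4) ^ a)) / real n"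
  proof -
    have "(1200 * (real a)\<^sup>2) ^ C = 1200 ^ C * real a ^ (2 * C)"
      by (simp only: power_mult_distrib power_mult)
    moreover have "r ^ a * (t ^ (a + 1) * (k * x / n * (k ^ C * x ^ (2 * C))))
      = t * k ^ (C + 1) * (x ^ (2 * C + 1) * (r ^ a * t ^ a)) / n" for r t k x n :: real
      by (simp add: mult_ac)
    ultimately show ?thesis by (simp only:)
  qed
  also have "(16 / 27) ^ a * (5 / 4) ^ a = (20 / 27 :: real) ^ a" by (simp flip: power_mult_distrib)
  finally show "expected n d a c \<le> 5 / 4 * 1200 ^ (C + 1) * (real a ^ (2 * C + 1) * (20 / 27) ^ a) / real n" .
qed

lemma summable_poly_geometric: "summable (\<lambda>a. real a ^ p * (20 / 27) ^ a)"
proof (rule summable_comparison_test_bigo)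
  \<comment> \<open>Any base strictly between 20/27 and 1 absorbs the polynomial factor.\<close>
  show "summable (\<lambda>a. norm ((25 / 27 :: real) ^ a))" by simp
  show "(\<lambda>a. real a ^ p * (20 / 27) ^ a) \<in> O(\<lambda>a. (25 / 27) ^ a)" by real_asymp
qed

section \<open>Random regular graphs\<close>

text \<open>The weight w does not depend on n: it is constant on the finitely many small sizes and
  polynomial times geometric beyond. Summing over all sizes therefore costs only a constant in front
  of 1/n.\<close>

lemma expected_le_summable:
  assumes d: "3 \<le> d"
  obtains w N where "summable w" "\<And>a. 0 \<le> w a"
    "\<And>n a c. N \<le> n \<Longrightarrow> 1 \<le> a \<Longrightarrow> 2 * a \<le> n \<Longrightarrow> c < C \<Longrightarrow> c + 2 * a < d * a \<Longrightarrow>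
       (\<forall>i\<le>a. 0 < fwd n d a (c + 2 * i)) \<and> expected n d a c \<le> w a / real n"
proof -
  define a0 where "a0 = 4 * C + 1"
  define K where "K = C + 2 * a0"
  define N where "N = 2 * K * (1 + 2 * d\<^sup>2) + K + 320 * d\<^sup>2 + 1"
  define M where "M = (real K + 2) ^ (2 * (a0 + 1))"
  define v where "v a = 5 / 4 * 1200 ^ (C + 1) * (real a ^ (2 * C + 1) * (20 / 27) ^ a)" for a
  define w where "w a = (if a < a0 then M else 0) + v a" for a
  have M: "0 \<le> M" by (simp add: M_def)
  have v: "0 \<le> v a" for a by (simp add: v_def)
  have "summable (\<lambda>a. if a < a0 then M else 0)"
    by (rule summable_finite[of "{..<a0}"]) auto
  moreover have "summable v" unfolding v_def by (intro summable_mult summable_poly_geometric)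
  ultimately have "summable w" unfolding w_def by (rule summable_add)
  moreover have "0 \<le> w a" for a using M v by (simp add: w_def)
  moreover have "(\<forall>i\<le>a. 0 < fwd n d a (c + 2 * i)) \<and> expected n d a c \<le> w a / real n"
    if n: "N \<le> n" and a: "1 \<le> a" "2 * a \<le> n" and c: "c < C" "c + 2 * a < d * a" for n a c
  proof (cases "a < a0")
    case True
    have "real (2 * K * (1 + 2 * d\<^sup>2)) \<le> real n" using n unfolding N_def by (intro of_nat_mono) linarith
    then have n1: "2 * real K * (1 + 2 * (real d)\<^sup>2) \<le> real n" by (simp add: algebra_simps)
    have n2: "K \<le> n" "0 < n" using n unfolding N_def by linarith+
    have cK: "c + 2 * a \<le> K" using c True unfolding K_def by linarith
    note small = expected_small[OF d cK c(2) a(2,1) n1 n2]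
    have "(real K + 2) ^ (2 * (a + 1)) \<le> M" unfolding M_def using True by (intro power_increasing) auto
    then have "(real K + 2) ^ (2 * (a + 1)) / real n \<le> w a / real n"
      using v[of a] True unfolding w_def by (intro divide_right_mono) auto
    then show ?thesis using small by (meson order_trans)
  next
    case False
    then have a0: "4 * C + 1 \<le> a" by (simp add: a0_def)
    have "real (320 * d\<^sup>2) \<le> real n" using n unfolding N_def by (intro of_nat_mono) linarith
    then have n1: "320 * (real d)\<^sup>2 \<le> real n" by simp
    show ?thesis using expected_large[OF d less_imp_le[OF c(1)] a0 a(2) n1] False
      unfolding w_def v_def by auto
  qed
  ultimately show ?thesis by (rule that)
qed

lemma sum_over_subsets:
  fixes g :: "nat \<Rightarrow> real"
  shows "(\<Sum>A | A \<subseteq> {1..n} \<and> 1 \<le> card A \<and> 2 * card A \<le> n. g (card A))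
    = (\<Sum>a | 1 \<le> a \<and> 2 * a \<le> n. real (n choose a) * g a)"
proof -
  let ?S = "{A. A \<subseteq> {1..n} \<and> 1 \<le> card A \<and> 2 * card A \<le> n}" and ?I = "{a. 1 \<le> a \<and> 2 * a \<le> n}"
  have fS: "finite ?S" by (rule finite_subset[of _ "Pow {1..n}"]) auto
  have fI: "finite ?I" by (rule finite_subset[of _ "{..n}"]) auto
  have "(\<Sum>A\<in>?S. g (card A)) = (\<Sum>a\<in>?I. \<Sum>A\<in>{A \<in> ?S. card A = a}. g (card A))"
    by (rule sum.group[symmetric]) (use fS fI in auto)
  also have "\<dots> = (\<Sum>a\<in>?I. real (n choose a) * g a)"
  proof (intro sum.cong refl)
    fix a assume a: "a \<in> ?I"
    have "{A \<in> ?S. card A = a} = {A. A \<subseteq> {1..n} \<and> card A = a}" using a by auto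
    moreover have "card {A. A \<subseteq> {1..n} \<and> card A = a} = n choose a"
      using n_subsets[of "{1..n}" a] by simp
    ultimately show "(\<Sum>A\<in>{A \<in> ?S. card A = a}. g (card A)) = real (n choose a) * g a" by simp
  qed
  finally show ?thesis .
qed

text \<open>A union bound over all violating sets A and over their boundary sizes, of which there
  are fewer than C.\<close>

lemma not_sparse_or_cut_rare:
  assumes d: "3 \<le> d"
  obtains K N where "\<And>n. N \<le> n \<Longrightarrow> real (card {E \<in> regular_graphs n d. \<not> sparse_or_cut n d C E})
     \<le> real (card (regular_graphs n d)) * (K / real n)"
proof -
  obtain w N where w: "summable w" "\<And>a. 0 \<le> w a"
    and N: "\<And>n a c. N \<le> n \<Longrightarrow> 1 \<le> a \<Longrightarrow> 2 * a \<le> n \<Longrightarrow> c < C \<Longrightarrow> c + 2 * a < d * a \<Longrightarrow>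
       (\<forall>i\<le>a. 0 < fwd n d a (c + 2 * i)) \<and> expected n d a c \<le> w a / real n"
    using expected_le_summable[OF d, of C] by blast
  have "real (card {E \<in> regular_graphs n d. \<not> sparse_or_cut n d C E})
     \<le> real (card (regular_graphs n d)) * (real C * suminf w / real n)" if n: "N \<le> n" for n
  proof -
    let ?R = "regular_graphs n d"
    define S where "S = {A. A \<subseteq> {1..n} \<and> 1 \<le> card A \<and> 2 * card A \<le> n}"
    define I where "I = {a. 1 \<le> a \<and> 2 * a \<le> n}"
    have fS: "finite S" unfolding S_def by (rule finite_subset[of _ "Pow {1..n}"]) auto
    have fI: "finite I" unfolding I_def by (rule finite_subset[of _ "{..n}"]) auto
    define cs where "cs a = {c. c < C \<and> c + 2 * a < d * a}" for a
    have fc: "finite (cs a)" for a unfolding cs_def by auto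
    define pr where "pr a c = (\<Prod>i<a + 1. bwd (c + 2 * i) / fwd n d a (c + 2 * i))" for a c
    have fG: "finite (cut_graphs n d A c)" for A c by (simp add: cut_graphs_def)
    have sub: "{E \<in> ?R. \<not> sparse_or_cut n d C E} \<subseteq> (\<Union>A\<in>S. \<Union>c\<in>cs (card A). cut_graphs n d A c)"
    proof
      fix E assume E: "E \<in> {E \<in> ?R. \<not> sparse_or_cut n d C E}"
      then obtain A where A: "A \<subseteq> {1..n}" "2 * card A \<le> n"
        and c: "card (arcs E A ({1..n} - A)) < C" "card (arcs E A ({1..n} - A)) + 2 * card A < d * card A"
        unfolding sparse_or_cut_def by (auto simp: not_le)
      \<comment> \<open>The empty set cannot violate the condition, because its second alternative
        reads 0 <= 0.\<close>
      have "A \<in> S" using A c(2) unfolding S_def by (cases "card A = 0") auto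
      moreover have "card (arcs E A ({1..n} - A)) \<in> cs (card A)" using c unfolding cs_def by simp
      ultimately show "E \<in> (\<Union>A\<in>S. \<Union>c\<in>cs (card A). cut_graphs n d A c)"
        using E unfolding cut_graphs_def by blast
    qed
    have "card {E \<in> ?R. \<not> sparse_or_cut n d C E} \<le> card (\<Union>A\<in>S. \<Union>c\<in>cs (card A). cut_graphs n d A c)"
      by (rule card_mono[OF _ sub]) (use fS fc fG in auto)
    also have "\<dots> \<le> (\<Sum>A\<in>S. card (\<Union>c\<in>cs (card A). cut_graphs n d A c))" by (rule card_UN_le[OF fS])
    also have "\<dots> \<le> (\<Sum>A\<in>S. \<Sum>c\<in>cs (card A). card (cut_graphs n d A c))"
      by (intro sum_mono card_UN_le fc)
    finally have "real (card {E \<in> ?R. \<not> sparse_or_cut n d C E})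
        \<le> (\<Sum>A\<in>S. \<Sum>c\<in>cs (card A). real (card (cut_graphs n d A c)))"
      by (simp only: flip: of_nat_sum)
    also have "\<dots> \<le> (\<Sum>A\<in>S. \<Sum>c\<in>cs (card A). real (card ?R) * pr (card A) c)"
    proof (intro sum_mono)
      fix A c assume A: "A \<in> S" and c: "c \<in> cs (card A)"
      have "0 < fwd n d (card A) (c + 2 * i)" if "i < card A + 1" for i
        using N[OF n, of "card A" c] A c that unfolding S_def cs_def by auto
      then show "real (card (cut_graphs n d A c)) \<le> real (card ?R) * pr (card A) c"
        unfolding pr_def using A by (intro card_cut_graphs_le) (auto simp: S_def)
    qed
    also have "\<dots> = real (card ?R) * (\<Sum>A\<in>S. \<Sum>c\<in>cs (card A). pr (card A) c)"
      by (simp add: sum_distrib_left)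
    also have "(\<Sum>A\<in>S. \<Sum>c\<in>cs (card A). pr (card A) c) = (\<Sum>a\<in>I. real (n choose a) * (\<Sum>c\<in>cs a. pr a c))"
      unfolding S_def I_def by (rule sum_over_subsets)
    also have "\<dots> \<le> (\<Sum>a\<in>I. real C * (w a / real n))"
    proof (intro sum_mono)
      fix a assume a: "a \<in> I"
      have "real (n choose a) * (\<Sum>c\<in>cs a. pr a c) = (\<Sum>c\<in>cs a. expected n d a c)"
        by (simp add: expected_def pr_def sum_distrib_left)
      also have "\<dots> \<le> (\<Sum>c\<in>cs a. w a / real n)"
        using N[OF n] a unfolding I_def cs_def by (intro sum_mono) auto
      also have "\<dots> = real (card (cs a)) * (w a / real n)" by simp
      also have "\<dots> \<le> real C * (w a / real n)"
      proof (intro mult_right_mono)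
        have "card (cs a) \<le> card {..<C}" unfolding cs_def by (intro card_mono) auto
        then show "real (card (cs a)) \<le> real C" by simp
      qed (use w in simp)
      finally show "real (n choose a) * (\<Sum>c\<in>cs a. pr a c) \<le> real C * (w a / real n)" .
    qed
    also have "\<dots> = real C * (\<Sum>a\<in>I. w a) / real n"
      by (simp add: sum_distrib_left sum_divide_distrib)
    also have "\<dots> \<le> real C * suminf w / real n"
      using w fI by (intro divide_right_mono mult_left_mono sum_le_suminf) auto
    finally show ?thesis by (simp add: mult_left_mono)
  qed
  then show ?thesis by (rule that)
qed

section \<open>Existence of regular graphs\<close>

text \<open>The step set of a circulant graph: d div 2 steps in either direction and, for odd d, the
  antipodal step n/2, which exists because n is then even.\<close>

lemma card_circulant_steps:
  assumes "d < n" "even (d * n)"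
  shows "card {s \<in> {1..<n}. s \<le> d div 2 \<or> n - s \<le> d div 2 \<or> odd d \<and> 2 * s = n} = d"
proof -
  define h where "h = d div 2"
  have h: "2 * h + 1 \<le> n" "d = 2 * h \<or> d = 2 * h + 1" using assms unfolding h_def by linarith+
  have eq: "{s \<in> {1..<n}. s \<le> d div 2 \<or> n - s \<le> d div 2 \<or> odd d \<and> 2 * s = n}
     = {1..h} \<union> {n - h..<n} \<union> {s. odd d \<and> 2 * s = n}"
    using assms h unfolding h_def[symmetric] by auto
  have "card {s. odd d \<and> 2 * s = n} = d - 2 * h"
  proof (cases "odd d")
    case True
    then have "even n" using assms by simp
    then have "{s. odd d \<and> 2 * s = n} = {n div 2}" using True by auto
    then show ?thesis using True h by auto
  next
    case False then show ?thesis using h by auto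
  qed
  moreover have "card ({1..h} \<union> {n - h..<n} \<union> {s. odd d \<and> 2 * s = n})
     = card {1..h} + card {n - h..<n} + card {s. odd d \<and> 2 * s = n}"
  proof -
    have "finite {s. odd d \<and> 2 * s = n}" by (rule finite_subset[of _ "{..n}"]) auto
    moreover have "({1..h} \<union> {n - h..<n}) \<inter> {s. odd d \<and> 2 * s = n} = {}"
      using h assms by auto
    moreover have "{1..h} \<inter> {n - h..<n} = {}" using h by auto
    ultimately show ?thesis by (simp add: card_Un_disjoint)
  qed
  ultimately show ?thesis unfolding eq using h by auto
qed

text \<open>Guards against a zero denominator: without regular graphs the quotient defining the
  probability would be 0.\<close>

lemma regular_graphs_nonempty:
  assumes "d < n" "even (d * n)"
  shows "regular_graphs n d \<noteq> {}"
proof -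
  define D where "D = {s \<in> {1..<n}. s \<le> d div 2 \<or> n - s \<le> d div 2 \<or> odd d \<and> 2 * s = n}"
  \<comment> \<open>The number of steps from v to u around the cycle of residues modulo n.\<close>
  define r where "r v u = nat ((int u - int v) mod int n)" for v u
  define E where "E = {{u, v} | u v. u \<in> {1..n} \<and> v \<in> {1..n} \<and> r v u \<in> D}"
  have n: "0 < n" using assms by simp
  have r_less: "r v u < n" for u v
    unfolding r_def using n by (simp add: nat_less_iff)
  have rD: "r u v \<in> D" if "r v u \<in> D" for u v
  proof -
    have "r v u \<noteq> 0" using that by (auto simp: D_def)
    then have nz: "(int u - int v) mod int n \<noteq> 0" unfolding r_def by simp
    have "(int v - int u) mod int n = (- (int u - int v)) mod int n" by simp
    also have "\<dots> = int n - (int u - int v) mod int n" using nz by (subst zmod_zminus1_eq_if) simp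
    finally have "r u v = n - r v u" unfolding r_def
      using n pos_mod_bound[of "int n" "int u - int v"] by (simp add: nat_diff_distrib less_imp_le)
    then show ?thesis using that by (auto simp: D_def)
  qed
  have irr: "r v v \<notin> D" for v unfolding r_def D_def by simp
  have iff: "{v, u} \<in> E \<longleftrightarrow> r v u \<in> D" if "u \<in> {1..n}" "v \<in> {1..n}" for u v
    using that rD unfolding E_def by (auto simp: doubleton_eq_iff)
  have sub: "E \<subseteq> all_edges n"
  proof
    fix e assume "e \<in> E"
    then obtain u v where uv: "e = {u, v}" "u \<in> {1..n}" "v \<in> {1..n}" "r v u \<in> D" unfolding E_def by blast
    then have "u \<noteq> v" using irr by blast
    then show "e \<in> all_edges n" using uv unfolding all_edges_def by simp
  qed
  have "card {u \<in> {1..n}. {v, u} \<in> E} = d" if v: "v \<in> {1..n}" for v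
  proof -
    have inj: "inj_on (r v) {1..n}"
    proof (rule inj_onI)
      fix x y assume xy: "x \<in> {1..n}" "y \<in> {1..n}" "r v x = r v y"
      then have "(int x - int v) mod int n = (int y - int v) mod int n"
        unfolding r_def using n by (simp add: nat_eq_iff)
      then have "int n dvd int x - int y" by (simp add: mod_eq_dvd_iff)
      moreover have "\<bar>int x - int y\<bar> < int n" using xy by auto
      ultimately have "int x - int y = 0" using dvd_imp_le_int by (metis not_less abs_of_nat)
      then show "x = y" by simp
    qed
    have "r v ` {1..n} = {..<n}"
      by (rule card_subset_eq) (use r_less inj in \<open>auto simp: card_image\<close>)
    then have "D \<subseteq> r v ` {1..n}" unfolding D_def by auto
    then have "r v ` {u \<in> {1..n}. r v u \<in> D} = D" by blast
    moreover have "{u \<in> {1..n}. {v, u} \<in> E} = {u \<in> {1..n}. r v u \<in> D}" using iff v by auto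
    moreover have "card (r v ` {u \<in> {1..n}. r v u \<in> D}) = card {u \<in> {1..n}. r v u \<in> D}"
      by (rule card_image) (rule inj_on_subset[OF inj], auto)
    ultimately show ?thesis using card_circulant_steps[OF assms] unfolding D_def by simp
  qed
  then have "E \<in> regular_graphs n d"
    using sub card_neighbours_eq[OF sub] unfolding regular_graphs_def by auto
  then show ?thesis by blast
qed

text \<open>Covers k = 1, which \<open>certificate_solvable\<close> excludes: each edge is a star by
  itself.\<close>

lemma has_star_decomposition_1:
  assumes "E \<in> regular_graphs n d" shows "has_star_decomposition 1 E"
  unfolding has_star_decomposition_def
proof (intro exI[of _ "(\<lambda>e. {e}) ` E"] conjI)
  show "\<forall>S\<in>(\<lambda>e. {e}) ` E. is_k_star 1 S"
    using assms by (auto simp: is_k_star_def regular_graphs_def all_edges_def card_2_iff)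
qed auto

theorem theorem1:
  fixes k d :: nat
  assumes "0 < k" and "0 < d" and "k < d"
    and "(k = 2 \<or> 2 * k dvd d) \<or> d \<ge> 2 * k^2 + k \<or> (odd k \<and> 3 \<le> k \<and> 2 * k < d)"
  shows "((\<lambda>n. prob_star_decomp n d k) \<longlongrightarrow> 1)
           (inf sequentially (principal (N_dk d k)))"
proof -
  let ?F = "inf sequentially (principal (N_dk d k))"
  have nonempty: "0 < card (regular_graphs n d)" if "n \<in> N_dk d k" "d < n" for n
  proof -
    have "even (d * n)" using that unfolding N_dk_def by (auto dest: dvd_mult_left)
    then show ?thesis using regular_graphs_nonempty[OF that(2)] by (simp add: card_gt_0_iff)
  qed
  obtain K N where K: "\<And>n. n \<in> N_dk d k \<Longrightarrow> d < n \<Longrightarrow> N \<le> n \<Longrightarrow>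
     real (card {E \<in> regular_graphs n d. \<not> has_star_decomposition k E})
       \<le> real (card (regular_graphs n d)) * (K / real n)"
  proof (cases "k = 1")
    case True
    have "{E \<in> regular_graphs n d. \<not> has_star_decomposition k E} = {}" for n
      using has_star_decomposition_1 True by blast
    then show ?thesis by (intro that[of 0 0]) simp
  next
    case False
    then have k: "2 \<le> k" using assms(1) by simp
    have kk: "k * 1 \<le> k * k" using k by (intro mult_le_mono) auto
    have d: "2 * k \<le> d + 1"
      using assms(4)
    proof (elim disjE)
      assume "2 * k dvd d"
      then have "2 * k \<le> d" using assms(2) by (rule dvd_imp_le)
      then show ?thesis by simp
    next
      assume "2 * k\<^sup>2 + k \<le> d" then show ?thesis using kk unfolding power2_eq_square by linarith
    qed (use assms(3) in auto)
    have d3: "3 \<le> d" using assms(3) k by simp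
    obtain K N where KN: "\<And>n. N \<le> n \<Longrightarrow> real (card {E \<in> regular_graphs n d. \<not> sparse_or_cut n d (3 * k - 2) E})
       \<le> real (card (regular_graphs n d)) * (K / real n)"
      using not_sparse_or_cut_rare[OF d3, of "3 * k - 2"] by blast
    have "real (card {E \<in> regular_graphs n d. \<not> has_star_decomposition k E})
       \<le> real (card (regular_graphs n d)) * (K / real n)" if "n \<in> N_dk d k" "N \<le> n" for n
    proof -
      have "2 * k dvd d * n" using that by (simp add: N_dk_def)
      then have "{E \<in> regular_graphs n d. \<not> has_star_decomposition k E}
          \<subseteq> {E \<in> regular_graphs n d. \<not> sparse_or_cut n d (3 * k - 2) E}"
        using star_decomposition_of_sparse[OF _ k d] by blast
      then have "card {E \<in> regular_graphs n d. \<not> has_star_decomposition k E}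
          \<le> card {E \<in> regular_graphs n d. \<not> sparse_or_cut n d (3 * k - 2) E}"
        by (intro card_mono) auto
      then show ?thesis using KN[OF that(2)] by linarith
    qed
    then show ?thesis using that[of N K] by blast
  qed
  have bounds: "1 - K / real n \<le> prob_star_decomp n d k" "prob_star_decomp n d k \<le> 1"
    if n: "n \<in> N_dk d k" "d < n" "N \<le> n" for n
  proof -
    let ?R = "regular_graphs n d"
    let ?G = "{E \<in> ?R. has_star_decomposition k E}" and ?B = "{E \<in> ?R. \<not> has_star_decomposition k E}"
    have "?R = ?G \<union> ?B" "?G \<inter> ?B = {}" by auto
    then have "card ?R = card ?G + card ?B" by (metis card_Un_disjoint finite_Un finite_regular_graphs)
    then have "real (card ?G) = real (card ?R) - real (card ?B)" by simp
    moreover have R: "0 < real (card ?R)" using nonempty[OF n(1,2)] by simp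
    ultimately have "(1 - K / real n) * real (card ?R) \<le> real (card ?G)"
      using K[OF n] by (simp add: algebra_simps)
    then show "1 - K / real n \<le> prob_star_decomp n d k"
      unfolding prob_star_decomp_def using R by (simp add: pos_le_divide_eq)
    have "card ?G \<le> card ?R" by (intro card_mono) auto
    then show "prob_star_decomp n d k \<le> 1"
      unfolding prob_star_decomp_def using R by (simp add: pos_divide_le_eq)
  qed
  \<comment> \<open>The principal filter supplies membership in \<open>N_dk\<close>, and the
    sequential one the lower bounds on n.\<close>
  have ev: "eventually (\<lambda>n. n \<in> N_dk d k \<and> d < n \<and> N \<le> n) ?F"
    unfolding eventually_inf_principal using eventually_ge_at_top[of "Suc d + N"]
    by (rule eventually_mono) auto
  show ?thesis
  proof (rule tendsto_sandwich)
    show "eventually (\<lambda>n. 1 - K / real n \<le> prob_star_decomp n d k) ?F"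
      using ev by (rule eventually_mono) (use bounds in blast)
    show "eventually (\<lambda>n. prob_star_decomp n d k \<le> 1) ?F"
      using ev by (rule eventually_mono) (use bounds in blast)
    have "((\<lambda>n. 1 - K / real n) \<longlongrightarrow> 1 - 0) sequentially"
      by (intro tendsto_intros lim_const_over_n)
    then show "((\<lambda>n. 1 - K / real n) \<longlongrightarrow> 1) ?F" by (intro tendsto_mono[OF inf_le1]) simp
    show "((\<lambda>_. 1) \<longlongrightarrow> (1::real)) ?F" by simp
  qed
qed

end
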